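(* Fix $c>0$, and let $v_1=(0,0)$, $v_2=(c^{-1},1)$, $v_3=(0,1)$ in $\mathbb{R}^2$, $\Theta_L=\operatorname{conv}(v_1,v_2,v_3)$, $\Theta_S=\operatorname{conv}(v_1,v_2)$, and $\theta^\star=v_1$. For any $\sigma>0$, the risks $R_\sigma(\theta^\star;\Theta_S)$ and $R_\sigma(\theta^\star;\Theta_L)$ admit exact closed-form expressions. Moreover, the following asymptotic comparisons hold. (i) (Vanishing-noise regime.) As $\sigma\to0^+$, $$R_\sigma(\theta^\star;\Theta_S)-R_\sigma(\theta^\star;\Theta_L)=-\frac{\sigma^2}{\pi}\arctan\frac1c+o(\sigma^2).$$ In particular, there exists $\sigma_0(c)>0$ such that for all $\sigma\in(0,\sigma_0(c))$, $R_\sigma(\theta^\star;\Theta_S)<R_\sigma(\theta^\star;\Theta_L)$. (ii) (Diverging-noise regime.) As $\sigma\to\infty$, $$R_\sigma(\theta^\star;\Theta_S)-R_\sigma(\theta^\star;\Theta_L)=\frac{1}{4c^2}-\frac{1+c^2}{2\pi c^2}\arctan\frac1c+o(1).$$ In particular, for $c\neq1$, there exists $\sigma_1(c)<\infty$ such that for all $\sigma\in(\sigma_1(c),\infty)$: $R_\sigma(\theta^\star;\Theta_S)>R_\sigma(\theta^\star;\Theta_L)$ if $0<c<1$, and $R_\sigma(\theta^\star;\Theta_S)<R_\sigma(\theta^\star;\Theta_L)$ if $c>1$. When $c=1$, the leading constant $\frac{1}{4c^2}-\frac{1+c^2}{2\pi c^2}\arctan\frac1c$ vanishes, so that $R_\sigma(\theta^\star;\Theta_S)-R_\sigma(\theta^\star;\Theta_L)=o(1)$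 as $\sigma\to\infty$.
   Context: For a nonempty compact convex set $\Theta\subseteq\mathbb{R}^d$, $\Pi_\Theta(y)=\arg\min_{\theta\in\Theta}\|y-\theta\|^2$ is the Euclidean projection of $y\in\mathbb{R}^d$ onto $\Theta$. In the Gaussian sequence model one observes a single realization $Y=\theta^\star+\sigma Z$ with $Z\sim N(0,I_d)$, noise level $\sigma>0$ and $\theta^\star\in\Theta$; the least squares estimator over $\Theta$ is $\Pi_\Theta(Y)$, and its squared-error risk is $R_\sigma(\theta^\star;\Theta)=\mathbb{E}\|\Pi_\Theta(\theta^\star+\sigma Z)-\theta^\star\|^2$. Here $d=2$. $\operatorname{conv}$ denotes the convex hull. *)

theory Defs
  imports "HOL-Probability.Probability" "HOL-Library.Landau_Symbols"
begin

definition std_gaussian :: "'a :: euclidean_space measure" where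
  "std_gaussian = density lborel (\<lambda>z. ennreal (\<Prod>b\<in>Basis. std_normal_density (z \<bullet> b)))"

definition ls_risk :: "real \<Rightarrow> 'a :: euclidean_space \<Rightarrow> 'a set \<Rightarrow> real" where
  "ls_risk \<sigma> \<theta> \<Theta> =
     (\<integral>z. (norm (closest_point \<Theta> (\<theta> + \<sigma> *\<^sub>R z) - \<theta>))\<^sup>2 \<partial>std_gaussian)"

abbreviation std_normal_cdf :: "real \<Rightarrow> real" where
  "std_normal_cdf \<equiv> cdf std_normal_distribution"

text \<open>Owen's T function: for \<open>h, k \<ge> 0\<close>, the probability that a standard Gaussian point
  \<open>(X, Y)\<close> satisfies \<open>X > h\<close> and \<open>0 < Y < k * X\<close>.\<close>

definition owen_T :: "real \<Rightarrow> real \<Rightarrow> real" where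
  "owen_T h k =
     1 / (2 * pi) * integral {0..k} (\<lambda>x. exp (- h\<^sup>2 * (1 + x\<^sup>2) / 2) / (1 + x\<^sup>2))"

text \<open>The expectation of \<open>Z\<^sup>2\<close> restricted to the event \<open>0 \<le> Z \<le> a\<close>, for a standard normal \<open>Z\<close>.\<close>

definition trunc_moment2 :: "real \<Rightarrow> real" where
  "trunc_moment2 a = std_normal_cdf a - 1 / 2 - a * std_normal_density a"

text \<open>Closed form for the segment. Its length is \<open>sqrt (1 + c\<^sup>2) / c\<close>, and the projection of the
  observation clips a one-dimensional Gaussian coordinate to this length.\<close>

definition segment_risk :: "real \<Rightarrow> real \<Rightarrow> real" where
  "segment_risk c \<sigma> =
     (let a = sqrt (1 + c\<^sup>2) / (c * \<sigma>)
      in \<sigma>\<^sup>2 * trunc_moment2 a + (1 + c\<^sup>2) / c\<^sup>2 * (1 - std_normal_cdf a))"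

text \<open>Closed form for the triangle, splitting the plane by the face that contains the projection.
  With \<open>v1 = (0,0)\<close>, \<open>v2 = (1/c,1)\<close>, \<open>v3 = (0,1)\<close>, the summands are, in order: the interior,
  the edges \<open>v1 v2\<close>, \<open>v1 v3\<close> and \<open>v2 v3\<close>, and the vertices \<open>v3\<close> and \<open>v2\<close>
  (the vertex \<open>v1\<close> contributes nothing). For \<open>v2\<close>, the last factor is the Gaussian
  measure of the (scaled) normal cone, which the ray from the origin through \<open>v2\<close> cuts into two pieces.\<close>

definition triangle_risk :: "real \<Rightarrow> real \<Rightarrow> real" where
  "triangle_risk c \<sigma> =
     (let h = 1 / \<sigma>; b = 1 / (c * \<sigma>); a = sqrt (1 + c\<^sup>2) / (c * \<sigma>)
      in \<sigma>\<^sup>2 * (arctan (1 / c) / pi - 2 * owen_T h (1 / c)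
                 - h * std_normal_density h * (std_normal_cdf b - 1 / 2))
       + \<sigma>\<^sup>2 * trunc_moment2 a / 2
       + \<sigma>\<^sup>2 * trunc_moment2 h / 2
       + (1 - std_normal_cdf h) * (\<sigma>\<^sup>2 * trunc_moment2 b + (std_normal_cdf b - 1 / 2))
       + (1 - std_normal_cdf h) / 2
       + (1 + c\<^sup>2) / c\<^sup>2 *
           ((1 - std_normal_cdf a) / 2
            + (owen_T h (1 / c) + 1 / 2 - std_normal_cdf b - std_normal_cdf h / 2
               + std_normal_cdf h * std_normal_cdf b)))"

end

theory Submission
  imports Defs "HOL-Real_Asymp.Real_Asymp"
begin

text \<open>
The point \<open>\<theta>\<close> is the origin, which is a vertex of both sets, so the risk is the mean of the squared
norm of the projected noise. Dilating by \<open>1 / \<sigma>\<close> turns the risk into \<open>\<sigma>\<^sup>2\<close> times the risk at unit noise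
over the dilated set (\<open>ls_risk_scaled\<close>). With \<open>h = 1 / \<sigma>\<close> and \<open>k = 1 / c\<close> this set is the segment from
\<open>0\<close> to \<open>(k h, h)\<close>, or the triangle with the additional vertex \<open>(0, h)\<close>; the length of the segment is
\<open>a = sqrt (1 + k\<^sup>2) h\<close>. Everything is then a statement about two functions of \<open>h\<close>, and the two noise
regimes are \<open>h \<rightarrow> \<infinity>\<close> and \<open>h \<rightarrow> 0\<close>.

For the closed forms, the plane is cut according to the face that contains the projection
(\<open>norm_closest_point_segment\<close>, \<open>norm_closest_point_triangle\<close>), and on each piece the squared norm
of the projection is integrated against the standard Gaussian. The pieces that are rectangles,
in the standard coordinates or in coordinates aligned with the long edge, split into one-dimensional
integrals; the aligned coordinates are again standard Gaussian by invariance under reflections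
(\<open>has_bochner_integral_std_gaussian_reflection\<close>). The two remaining pieces lie in the wedge
\<open>0 \<le> x \<le> k y\<close>. There the substitution \<open>x = t y\<close>
(\<open>nn_integral_std_normal_pair_wedge\<close>) makes the integral over \<open>y\<close> elementary and leaves an integral over
the slope \<open>t \<in> [0, k]\<close>, which gives \<open>arctan\<close>, Owen's function and a normal probability.

As \<open>h \<rightarrow> \<infinity>\<close> all tails vanish even after multiplication by \<open>h\<^sup>2\<close>. What stays is \<open>1 / 2\<close> for the segment,
and \<open>1 / 4\<close> for each of the two edges at the origin plus \<open>arctan k / \<pi>\<close> for the cone between them for
the triangle. As \<open>h \<rightarrow> 0\<close> everything but the contribution of the vertices is of smaller order
than \<open>h\<^sup>2\<close>, and after division by \<open>h\<^sup>2\<close> the limit is the sum over the vertices of the squared norm times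
the Gaussian measure of the normal cone. The sign of the resulting constant follows from Jordan's
inequality \<open>2 x / \<pi> < sin x\<close> (\<open>jordan_sin_strict\<close>), after it is rewritten in terms of
\<open>x = \<pi> / 2 - 2 arctan k\<close>.
\<close>

section \<open>Projection onto segments and triangles\<close>

text \<open>The variational inequality characterises the projection: expanding \<open>y - v = (y - x) - (v - x)\<close>
shows that an obtuse angle at \<open>x\<close> makes \<open>x\<close> at least as close to \<open>y\<close> as \<open>v\<close> is.\<close>

lemma closest_point_eqI:
  fixes S :: "'a :: euclidean_space set"
  assumes "convex S" "closed S" "x \<in> S" and obtuse: "\<And>v. v \<in> S \<Longrightarrow> (y - x) \<bullet> (v - x) \<le> 0"
  shows "closest_point S y = x"
proof (rule closest_point_unique[symmetric])
  show "\<forall>v\<in>S. dist y x \<le> dist y v"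
  proof
    fix v assume v: "v \<in> S"
    have "(y - v) \<bullet> (y - v) = (y - x) \<bullet> (y - x) - 2 * ((y - x) \<bullet> (v - x)) + (v - x) \<bullet> (v - x)"
      by (simp add: inner_simps inner_commute)
    hence "(dist y x)\<^sup>2 \<le> (dist y v)\<^sup>2"
      using obtuse[OF v] inner_ge_zero[of "v - x"] unfolding dist_norm power2_norm_eq_inner by linarith
    thus "dist y x \<le> dist y v" by (simp add: power2_le_iff_abs_le)
  qed
qed (use assms in auto)

text \<open>For a polytope it is enough to test the variational inequality at the vertices, because the points
\<open>v\<close> that satisfy it form a convex set.\<close>

lemma closest_point_convex_hull_eqI:
  fixes V :: "'a :: euclidean_space set"
  assumes "finite V" "x \<in> convex hull V" and obtuse: "\<And>v. v \<in> V \<Longrightarrow> (y - x) \<bullet> (v - x) \<le> 0"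
  shows "closest_point (convex hull V) y = x"
proof (rule closest_point_eqI)
  have "convex hull V \<subseteq> {v. (y - x) \<bullet> v \<le> (y - x) \<bullet> x}"
    using obtuse by (intro hull_minimal convex_halfspace_le) (auto simp: inner_diff_right)
  thus "(y - x) \<bullet> (v - x) \<le> 0" if "v \<in> convex hull V" for v
    using that by (auto simp: inner_diff_right)
qed (use assms in \<open>auto intro: compact_imp_closed finite_imp_compact_convex_hull\<close>)

lemma closest_point_scaled:
  fixes S :: "'a :: euclidean_space set"
  assumes "convex S" "closed S" "S \<noteq> {}" "r > 0"
  shows "closest_point ((*\<^sub>R) r ` S) (r *\<^sub>R z) = r *\<^sub>R closest_point S z"
proof (rule closest_point_eqI)
  show "r *\<^sub>R closest_point S z \<in> (*\<^sub>R) r ` S"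
    using assms closest_point_in_set by blast
  fix v assume "v \<in> (*\<^sub>R) r ` S"
  then obtain w where w: "w \<in> S" "v = r *\<^sub>R w" by auto
  have "(z - closest_point S z) \<bullet> (w - closest_point S z) \<le> 0"
    using assms w closest_point_dot by blast
  hence "r * r * ((z - closest_point S z) \<bullet> (w - closest_point S z)) \<le> 0"
    by (simp add: mult_le_0_iff)
  thus "(r *\<^sub>R z - r *\<^sub>R closest_point S z) \<bullet> (v - r *\<^sub>R closest_point S z) \<le> 0"
    unfolding w scaleR_right_diff_distrib[symmetric] by (simp add: mult.assoc)
qed (use assms in \<open>auto intro: closed_scaling convex_scaling\<close>)

text \<open>Projections commute with dilations about the origin, so the noise level can be moved into the set.\<close>

lemma ls_risk_scaled:
  fixes S :: "'a :: euclidean_space set"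
  assumes "convex S" "closed S" "S \<noteq> {}" "\<sigma> > 0"
  shows "ls_risk \<sigma> 0 ((*\<^sub>R) \<sigma> ` S) = \<sigma>\<^sup>2 * ls_risk 1 0 S"
  unfolding ls_risk_def using assms
  by (simp add: closest_point_scaled power_mult_distrib)

lemma inner_real2: "(x :: real^2) \<bullet> y = x$1 * y$1 + x$2 * y$2"
  by (simp add: inner_vec_def sum_2)

lemma real2_eq_iff: "(x :: real^2) = y \<longleftrightarrow> x$1 = y$1 \<and> x$2 = y$2"
  by (simp add: vec_eq_iff forall_2)

lemma norm_real2_sq: "(norm (x :: real^2))\<^sup>2 = (x$1)\<^sup>2 + (x$2)\<^sup>2"
  unfolding power2_norm_eq_inner by (simp add: inner_real2 power2_eq_square)

text \<open>Here \<open>s\<close> is the coordinate of \<open>z\<close> along the segment and \<open>a\<close> is the length of the segment; the projection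
clips \<open>s\<close> to \<open>[0, a]\<close>.\<close>

lemma norm_closest_point_segment:
  fixes z :: "real^2"
  assumes "b > 0" "h > 0" "a > 0" "a\<^sup>2 = b\<^sup>2 + h\<^sup>2"
  defines "s \<equiv> (b * z$1 + h * z$2) / a"
  shows "(norm (closest_point (convex hull {0, vector [b, h]}) z))\<^sup>2 =
    s\<^sup>2 * indicator {0<..<a} s + a\<^sup>2 * indicator {a..} s"
proof -
  define w where "w = (vector [b, h] :: real^2)"
  have w: "w$1 = b" "w$2 = h" by (simp_all add: w_def)
  have sa: "b * z$1 + h * z$2 = s * a" using assms by (simp add: s_def)
  have in_seg: "u *\<^sub>R w \<in> convex hull {0, w}" if "0 \<le> u" "u \<le> 1" for u
    using that by (auto simp: segment_convex_hull[symmetric] in_segment)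
  have cp: "closest_point (convex hull {0, w}) z = u *\<^sub>R w"
    if "0 \<le> u" "u \<le> 1" "u * (s - u * a) \<ge> 0" "(1 - u) * (s - u * a) \<le> 0" for u
  proof (rule closest_point_convex_hull_eqI)
    fix v assume v: "v \<in> {0, w}"
    have "(z - u *\<^sub>R w) \<bullet> w = (b * z$1 + h * z$2) - u * (b\<^sup>2 + h\<^sup>2)"
      by (simp add: inner_real2 w algebra_simps power2_eq_square)
    hence i: "(z - u *\<^sub>R w) \<bullet> w = a * (s - u * a)"
      unfolding sa assms(4)[symmetric] by (simp add: algebra_simps power2_eq_square)
    have "(z - u *\<^sub>R w) \<bullet> (0 - u *\<^sub>R w) = - (u * ((z - u *\<^sub>R w) \<bullet> w))"
         "(z - u *\<^sub>R w) \<bullet> (w - u *\<^sub>R w) = (1 - u) * ((z - u *\<^sub>R w) \<bullet> w)"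
      by (simp_all only: inner_diff_right inner_scaleR_right inner_zero_right) (simp_all add: algebra_simps)
    hence "(z - u *\<^sub>R w) \<bullet> (0 - u *\<^sub>R w) = - (a * (u * (s - u * a)))"
         "(z - u *\<^sub>R w) \<bullet> (w - u *\<^sub>R w) = a * ((1 - u) * (s - u * a))"
      unfolding i by (simp_all only: mult_ac)
    moreover have "- (a * (u * (s - u * a))) \<le> 0" "a * ((1 - u) * (s - u * a)) \<le> 0"
      using that assms by (simp_all add: mult_le_0_iff)
    ultimately show "(z - u *\<^sub>R w) \<bullet> (v - u *\<^sub>R w) \<le> 0" using v by (metis insertE singletonD)
  qed (use that in_seg in auto)
  have nw: "(norm (u *\<^sub>R w))\<^sup>2 = u\<^sup>2 * a\<^sup>2" for u
    by (simp add: norm_real2_sq w assms(4) power_mult_distrib algebra_simps)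
  note cp = cp[unfolded w_def] and nw = nw[unfolded w_def]
  consider "s \<le> 0" | "0 < s" "s < a" | "a \<le> s" by linarith
  thus ?thesis
  proof cases
    case 1 thus ?thesis using cp[of 0] assms(3) by simp
  next
    case 2 thus ?thesis using cp[of "s/a"] nw[of "s/a"] assms(3) by (simp add: field_simps)
  next
    case 3 thus ?thesis using cp[of 1] nw[of 1] assms(3) by simp
  qed
qed

text \<open>The summands belong to the interior, the long edge, the edges from \<open>0\<close> to \<open>(0, h)\<close> and from \<open>(0, h)\<close> to
\<open>(k h, h)\<close>, the vertex \<open>(0, h)\<close> and the vertex \<open>(k h, h)\<close>; the normal cone of the origin contributes
nothing. The coordinates \<open>s\<close> and \<open>t\<close> are taken along the long edge and orthogonally to it, with \<open>t > 0\<close> on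
the outer side. The normal cone of \<open>(k h, h)\<close> is cut along the ray through this vertex. Its part with
\<open>t > 0\<close> is a quadrant in the coordinates \<open>s\<close> and \<open>t\<close>; the other part consists of the points of the wedge
\<open>0 \<le> x \<le> k y\<close> above height \<open>h\<close>, without the strip \<open>0 \<le> x < k h\<close>, which is why it is written as a difference.\<close>

lemma norm_closest_point_triangle:
  fixes z :: "real^2"
  assumes "k > 0" "h > 0" "a > 0" "a\<^sup>2 = (k * h)\<^sup>2 + h\<^sup>2"
  defines "x \<equiv> z$1" and "y \<equiv> z$2"
  defines "s \<equiv> (k * h * x + h * y) / a" and "t \<equiv> (h * x - k * h * y) / a"
  shows "(norm (closest_point (convex hull {0, vector [k * h, h], vector [0, h]}) z))\<^sup>2 =
      (if 0 \<le> x \<and> x \<le> k * y then (x\<^sup>2 + y\<^sup>2) * indicator {..h} y else 0)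
    + s\<^sup>2 * indicator {0<..<a} s * indicator {0<..} t
    + indicator {..<0} x * (y\<^sup>2 * indicator {0<..h} y)
    + (x\<^sup>2 + h\<^sup>2) * indicator {0<..<k*h} x * indicator {h<..} y
    + h\<^sup>2 * (indicator {..0} x * indicator {h<..} y)
    + a\<^sup>2 * (indicator {a..} s * indicator {0<..} t
       + (if 0 \<le> x \<and> x \<le> k * y then indicator {h<..} y else 0)
       - indicator {0..<k*h} x * indicator {h<..} y)"
proof -
  define w where "w = (vector [k * h, h] :: real^2)"
  define w' where "w' = (vector [0, h] :: real^2)"
  let ?T = "convex hull {0, w, w'}"
  have w: "w$1 = k * h" "w$2 = h" "w'$1 = 0" "w'$2 = h" by (simp_all add: w_def w'_def)
  have mem: "vector [p, q] \<in> ?T" if "0 \<le> p" "p \<le> k * q" "q \<le> h" for p q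
  proof -
    define u where "u = p / (k * h)"
    define v where "v = q / h - p / (k * h)"
    have "(vector [p, q] :: real^2) = (1 - u - v) *\<^sub>R 0 + u *\<^sub>R w + v *\<^sub>R w'"
      using assms(1,2) by (simp add: real2_eq_iff w u_def v_def field_simps)
    moreover have "0 \<le> u" "0 \<le> v" "0 \<le> 1 - u - v"
      using that assms(1,2) by (auto simp: u_def v_def field_simps)
    ultimately show ?thesis unfolding convex_hull_3 mem_Collect_eq
      by (intro exI[of _ "1 - u - v"] exI[of _ u] exI[of _ v]) auto
  qed
  have cp: "(norm (closest_point ?T z))\<^sup>2 = p\<^sup>2 + q\<^sup>2"
    if "0 \<le> p" "p \<le> k * q" "q \<le> h"
       "(x - p) * p + (y - q) * q \<ge> 0"
       "(x - p) * (k * h - p) + (y - q) * (h - q) \<le> 0"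
       "(x - p) * (- p) + (y - q) * (h - q) \<le> 0" for p q
  proof -
    have "closest_point ?T z = vector [p, q]"
      by (rule closest_point_convex_hull_eqI)
         (use that mem in \<open>auto simp: inner_real2 w x_def[symmetric] y_def[symmetric] algebra_simps\<close>)
    thus ?thesis by (simp add: norm_real2_sq)
  qed
  have sa: "k * h * x + h * y = s * a" using assms(3) by (simp add: s_def)
  have t_pos: "0 < t \<longleftrightarrow> k * y < x"
  proof -
    have "t = h / a * (x - k * y)" by (simp add: t_def field_simps)
    thus ?thesis using assms(2,3) by (simp add: zero_less_mult_iff zero_less_divide_iff)
  qed
  have s_pos: "0 < s \<longleftrightarrow> 0 < k * x + y"
  proof -
    have "s = h / a * (k * x + y)" by (simp add: s_def field_simps)
    thus ?thesis using assms(2,3) by (simp add: zero_less_mult_iff zero_less_divide_iff)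
  qed
  have s_less: "s < a \<longleftrightarrow> k * x + y < (k\<^sup>2 + 1) * h"
  proof -
    have "s < a \<longleftrightarrow> s * a < a\<^sup>2" using assms(3) by (simp add: power2_eq_square)
    also have "s * a = h * (k * x + y)" unfolding sa[symmetric] by (simp add: algebra_simps)
    also have "a\<^sup>2 = h * ((k\<^sup>2 + 1) * h)" unfolding assms(4) by (simp add: algebra_simps power2_eq_square)
    finally show ?thesis using assms(2) by simp
  qed
  \<comment> \<open>The orthogonal projection of \<open>(x, y)\<close> onto the line of the long edge is \<open>(r * k, r)\<close>.\<close>
  define r where "r = (k * x + y) / (k\<^sup>2 + 1)"
  have k1: "k\<^sup>2 + 1 > 0" by (simp add: add_nonneg_pos)
  have r: "k * x + y = r * (k\<^sup>2 + 1)" using k1 by (simp add: r_def)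
  have s_r: "s\<^sup>2 = (r * k)\<^sup>2 + r\<^sup>2"
  proof -
    have "a\<^sup>2 * s\<^sup>2 = (h * (k * x + y))\<^sup>2" using sa by (simp add: algebra_simps flip: power_mult_distrib)
    also have "\<dots> = a\<^sup>2 * ((r * k)\<^sup>2 + r\<^sup>2)"
      unfolding r assms(4) by (simp add: algebra_simps power2_eq_square)
    finally show ?thesis using assms(3) by simp
  qed
  have le_s: "a \<le> s \<longleftrightarrow> (k\<^sup>2 + 1) * h \<le> k * x + y" using s_less by linarith
  note cp = cp[unfolded w_def w'_def]
  note [simp] = t_pos s_pos s_less le_s
  note cases_simps = indicator_def not_less not_le
  \<comment> \<open>In case 1 the point lies in the triangle. Cases 7, 5 and 2 project to the long, the left and the top
    edge, cases 3, 4 and 8 to the vertices other than the origin, and cases 6 and 9 to the origin.\<close>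
  consider "0 \<le> x" "x \<le> k * y" "y \<le> h" | "0 < x" "x < k * h" "h < y" | "x \<le> 0" "h < y"
    | "k * h \<le> x" "x \<le> k * y" "h < y" | "x < 0" "0 < y" "y \<le> h"
    | "k * y < x" "k * x + y \<le> 0" | "k * y < x" "0 < k * x + y" "k * x + y < (k\<^sup>2 + 1) * h"
    | "k * y < x" "(k\<^sup>2 + 1) * h \<le> k * x + y" | "x < 0" "y \<le> 0" "x \<le> k * y"
    by linarith
  thus ?thesis
  proof cases
    case 1
    thus ?thesis using cp[of x y] by (simp add: cases_simps)
  next
    case 2
    moreover have "k * h < k * y" "0 \<le> (y - h) * h" using 2 assms(1,2) by simp_all
    ultimately show ?thesis using cp[of x h] by (simp add: cases_simps)
  next
    case 3
    moreover have "0 < k * y" "0 \<le> (y - h) * h" "x * (k * h) \<le> 0" "0 < k * h"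
      using 3 assms(1,2) by (simp_all add: mult_le_0_iff)
    moreover have "x \<le> k * y" using 3 \<open>0 < k * y\<close> by linarith
    ultimately show ?thesis using cp[of 0 h] assms(1,2) by (simp add: cases_simps)
  next
    case 4
    moreover have "0 < k * h" "0 \<le> (y - h) * h" "0 \<le> (x - k * h) * (k * h)"
      using 4 assms(1,2) by simp_all
    moreover have "0 < x" using 4 \<open>0 < k * h\<close> by linarith
    ultimately show ?thesis using cp[of "k * h" h] assms(1,2,4) by (simp add: cases_simps)
  next
    case 5
    moreover have "0 < k * y" "x * (k * h) \<le> 0"
      using 5 assms(1,2) by (simp_all add: mult_le_0_iff)
    moreover have "x \<le> k * y" using 5 \<open>0 < k * y\<close> by linarith
    ultimately show ?thesis using cp[of 0 y] assms(1,2) by (simp add: cases_simps)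
  next
    case 6
    have "y < 0"
    proof (rule ccontr)
      assume "\<not> y < 0"
      hence "0 \<le> k * y" using assms(1) by simp
      hence "0 < k * x" using 6 assms(1) by simp
      thus False using 6 \<open>\<not> y < 0\<close> by linarith
    qed
    moreover have "x * (k * h) + y * h = h * (k * x + y)" by (simp add: algebra_simps)
    hence "x * (k * h) + y * h \<le> 0" using 6 assms(2) by (simp add: mult_le_0_iff)
    moreover have "0 < (k\<^sup>2 + 1) * h" using k1 assms(2) by simp
    hence "k * x + y < (k\<^sup>2 + 1) * h" using 6 by linarith
    moreover have "y * h \<le> 0" using \<open>y < 0\<close> assms(2) by (simp add: mult_le_0_iff)
    ultimately show ?thesis using cp[of 0 0] 6 assms(1,2) by (simp add: cases_simps)
  next
    case 7
    have x: "0 < x"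
    proof (rule ccontr)
      assume "\<not> 0 < x"
      hence "k * x \<le> 0" using assms(1) by (simp add: mult_le_0_iff)
      hence "0 < k * y" using 7 assms(1) by simp
      thus False using 7 \<open>\<not> 0 < x\<close> by linarith
    qed
    have y: "y \<le> h \<or> k * h < x"
    proof (rule ccontr)
      assume "\<not> (y \<le> h \<or> k * h < x)"
      hence "k * h < k * y" using assms(1) by simp
      thus False using 7 \<open>\<not> (y \<le> h \<or> k * h < x)\<close> by linarith
    qed
    have "0 < r" "r < h" using 7 k1 by (simp_all add: r zero_less_mult_iff)
    moreover have ry: "y \<le> r"
    proof -
      have "k * (k * y) < k * x" using 7 assms(1) by simp
      hence "y * (k\<^sup>2 + 1) \<le> r * (k\<^sup>2 + 1)" unfolding r[symmetric] by (simp add: algebra_simps power2_eq_square)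
      thus ?thesis using k1 by simp
    qed
    moreover have "(x - r * k) * (r * k) + (y - r) * r = 0"
    proof -
      have "(x - r * k) * (r * k) + (y - r) * r = r * (k * x + y - r * (k\<^sup>2 + 1))"
        by (simp add: algebra_simps power2_eq_square)
      thus ?thesis using r by simp
    qed
    moreover have "(x - r * k) * (k * h - r * k) + (y - r) * (h - r) = 0"
    proof -
      have "(x - r * k) * (k * h - r * k) + (y - r) * (h - r) = (h - r) * (k * x + y - r * (k\<^sup>2 + 1))"
        by (simp add: algebra_simps power2_eq_square)
      thus ?thesis using r by simp
    qed
    moreover have "(x - r * k) * - (r * k) + (y - r) * (h - r) \<le> 0"
    proof -
      have "(x - r * k) * - (r * k) + (y - r) * (h - r) = (y - r) * h - r * (k * x + y - r * (k\<^sup>2 + 1))"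
        by (simp add: algebra_simps power2_eq_square)
      thus ?thesis using r ry assms(2) by (simp add: mult_le_0_iff)
    qed
    ultimately show ?thesis using cp[of "r * k" r] 7 x y s_r assms(1,2) by (auto simp: cases_simps)
  next
    case 8
    have "k * h < x"
    proof -
      have "(k\<^sup>2 + 1) * (k * h) \<le> k * (k * x + y)"
        using mult_left_mono[OF 8(2), of k] assms(1) by (simp add: algebra_simps)
      also have "\<dots> < (k\<^sup>2 + 1) * x" using 8(1) by (simp add: algebra_simps power2_eq_square)
      finally show ?thesis using k1 by simp
    qed
    moreover have "(x - k * h) * (k * h) + (y - h) * h \<ge> 0"
    proof -
      have "(x - k * h) * (k * h) + (y - h) * h = h * (k * x + y - (k\<^sup>2 + 1) * h)"
        by (simp add: algebra_simps power2_eq_square)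
      thus ?thesis using 8 assms(2) by simp
    qed
    moreover have "0 < k * h" "(x - k * h) * (k * h) \<ge> 0" using \<open>k * h < x\<close> assms(1,2) by simp_all
    moreover have "0 < x" using \<open>0 < k * h\<close> \<open>k * h < x\<close> by linarith
    ultimately show ?thesis using cp[of "k * h" h] 8 assms(1,2,4) by (simp add: cases_simps)
  next
    case 9
    moreover have "k * x < 0" "x * (k * h) \<le> 0" "y * h \<le> 0" "k * y \<le> 0" using 9 assms(1,2) by (simp_all add: mult_le_0_iff mult_less_0_iff)
    moreover have "0 < (k\<^sup>2 + 1) * h" using k1 assms(2) by simp
    ultimately show ?thesis using cp[of 0 0] assms(2) by (simp add: cases_simps)
  qed
qed

section \<open>The standard Gaussian in the plane\<close>

lemma vector_2_expand: "(vector [x, y] :: real^2) = x *\<^sub>R axis 1 1 + y *\<^sub>R axis 2 1"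
  by (simp add: vec_eq_iff forall_2 axis_def)

lemma measurable_vector_2 [measurable]:
  assumes [measurable]: "f \<in> borel_measurable M" "g \<in> borel_measurable M"
  shows "(\<lambda>z. vector [f z, g z] :: real^2) \<in> borel_measurable M"
  unfolding vector_2_expand by measurable

lemma measurable_vec_nth_real2 [measurable]: "(\<lambda>z :: real^2. z $ i) \<in> borel_measurable borel"
  by (intro borel_measurable_continuous_onI continuous_intros)

lemma prod_Basis_real2: "(\<Prod>b\<in>(Basis :: (real^2) set). f b) = f (axis 1 1) * f (axis 2 1)"
proof -
  have "(Basis :: (real^2) set) = {axis 1 1, axis 2 1}"
    by (auto simp: Basis_vec_def UNIV_2)
  hence "(\<Prod>b\<in>Basis. f b) = prod f {axis 1 1, axis 2 1 :: real^2}" by (rule arg_cong)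
  thus ?thesis by (simp add: axis_eq_axis)
qed

lemma lborel_real2: "(lborel :: (real^2) measure) = distr (lborel \<Otimes>\<^sub>M lborel) borel (\<lambda>z. vector [fst z, snd z])"
proof (rule lborel_eqI)
  fix l u :: "real^2" assume le: "\<And>b. b \<in> Basis \<Longrightarrow> l \<bullet> b \<le> u \<bullet> b"
  have "axis i 1 \<in> (Basis :: (real^2) set)" for i by (auto simp: axis_in_Basis_iff)
  hence le': "l $ i \<le> u $ i" for i using le[of "axis i 1"] by (simp add: inner_axis)
  have eq: "(\<lambda>z. vector [fst z, snd z]) -` box l u \<inter> space (lborel \<Otimes>\<^sub>M lborel)
      = {l$1<..<u$1} \<times> {l$2<..<u$2}"
    by (auto simp: mem_box_cart forall_2 space_pair_measure)
  have "emeasure (distr (lborel \<Otimes>\<^sub>M lborel) borel (\<lambda>z. vector [fst z, snd z])) (box l u)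
      = emeasure (lborel \<Otimes>\<^sub>M lborel) ({l$1<..<u$1} \<times> {l$2<..<u$2})"
    by (subst emeasure_distr) (simp_all only: eq, measurable)
  also have "\<dots> = ennreal ((u$1 - l$1) * (u$2 - l$2))"
    by (simp add: lborel.emeasure_pair_measure_Times le' ennreal_mult)
  finally show "emeasure (distr (lborel \<Otimes>\<^sub>M lborel) borel (\<lambda>z. vector [fst z, snd z])) (box l u)
      = ennreal (\<Prod>b\<in>Basis. (u - l) \<bullet> b)"
    by (simp add: prod_Basis_real2 inner_axis)
qed simp

abbreviation std_normal_pair :: "(real \<times> real) measure" where
  "std_normal_pair \<equiv> std_normal_distribution \<Otimes>\<^sub>M std_normal_distribution"

interpretation N: real_distribution std_normal_distribution
  by (rule real_dist_normal_dist)
interpretation NN: pair_prob_space std_normal_distribution std_normal_distribution ..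

lemma std_normal_pair_density:
  "std_normal_pair = density (lborel \<Otimes>\<^sub>M lborel)
     (\<lambda>z. ennreal (std_normal_density (fst z) * std_normal_density (snd z)))"
  by (subst pair_measure_density)
     (auto simp: ennreal_mult' case_prod_unfold sigma_finite_lborel N.sigma_finite_measure_axioms)

lemma std_gaussian_real2:
  "(std_gaussian :: (real^2) measure) = distr std_normal_pair borel (\<lambda>z. vector [fst z, snd z])"
  unfolding std_gaussian_def lborel_real2 std_normal_pair_density
  by (subst density_distr) (simp_all add: prod_Basis_real2 inner_axis)

lemma has_bochner_integral_distr_iff:
  fixes f :: "'b \<Rightarrow> real"
  assumes "g \<in> measurable M N" "f \<in> borel_measurable N"
  shows "has_bochner_integral (distr M N g) f r \<longleftrightarrow> has_bochner_integral M (\<lambda>x. f (g x)) r"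
  using integrable_distr_eq[OF assms] integral_distr[OF assms] by (simp add: has_bochner_integral_iff)

lemma has_bochner_integral_std_gaussian_real2:
  fixes f :: "real \<times> real \<Rightarrow> real"
  assumes "has_bochner_integral std_normal_pair f r"
  shows "has_bochner_integral (std_gaussian :: (real^2) measure) (\<lambda>z. f (z$1, z$2)) r"
proof -
  have [measurable]: "f \<in> borel_measurable (borel \<Otimes>\<^sub>M borel)"
    using assms by (auto simp: has_bochner_integral_iff dest!: borel_measurable_integrable)
  show ?thesis unfolding std_gaussian_real2
    by (subst has_bochner_integral_distr_iff) (use assms in auto)
qed

text \<open>The matrix with rows \<open>(p, q)\<close> and \<open>(q, -p)\<close> is a reflection. It is used instead of the rotation with
the same first row because it is its own inverse, so preimages of boxes are images of boxes, and
measures of images under orthogonal maps are preserved.\<close>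

lemma lborel_reflection:
  fixes p q :: real
  assumes "p\<^sup>2 + q\<^sup>2 = 1"
  defines "R \<equiv> \<lambda>z :: real^2. vector [p * z$1 + q * z$2, q * z$1 - p * z$2] :: real^2"
  shows "distr lborel borel R = lborel"
proof (rule lborel_eqI[symmetric])
  fix l u :: "real^2" assume le: "\<And>b. b \<in> Basis \<Longrightarrow> l \<bullet> b \<le> u \<bullet> b"
  have [measurable]: "R \<in> borel_measurable borel" unfolding R_def by measurable
  have RR: "R (R z) = z" for z
  proof -
    have "p * (p * x + q * y) + q * (q * x - p * y) = (p\<^sup>2 + q\<^sup>2) * x"
         "q * (p * x + q * y) - p * (q * x - p * y) = (p\<^sup>2 + q\<^sup>2) * y" for x y
      by (simp_all add: algebra_simps power2_eq_square)
    thus ?thesis using assms(1) by (simp add: R_def vec_eq_iff forall_2)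
  qed
  have "orthogonal_transformation R"
  proof -
    have "(p * x + q * y)\<^sup>2 + (q * x - p * y)\<^sup>2 = (p\<^sup>2 + q\<^sup>2) * (x\<^sup>2 + y\<^sup>2)" for x y
      by (simp add: algebra_simps power2_eq_square)
    hence "(p * x + q * y)\<^sup>2 + (q * x - p * y)\<^sup>2 = x\<^sup>2 + y\<^sup>2" for x y
      using assms(1) by simp
    hence "norm (R z) = norm z" for z
      by (simp add: R_def norm_vec_def L2_set_def sum_2)
    moreover have "linear R"
      by (rule linearI) (simp_all add: R_def vec_eq_iff forall_2 algebra_simps)
    ultimately show ?thesis by (simp add: orthogonal_transformation)
  qed
  have im: "R -` box l u = R ` box l u" 
  proof safe
    fix z assume "R z \<in> box l u"
    thus "z \<in> R ` box l u" using RR by (metis imageI)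
  qed (simp add: RR)
  have "R -` box l u \<in> sets borel" using measurable_sets[of R borel borel "box l u"] by simp
  have "R ` box l u \<in> lmeasurable" "measure lebesgue (R ` box l u) = measure lebesgue (box l u)"
    by (rule measurable_orthogonal_image measure_orthogonal_image; fact?; simp)+
  have "emeasure (distr lborel borel R) (box l u) = emeasure lborel (R ` box l u)"
    by (simp add: emeasure_distr im)
  also have "\<dots> = emeasure lebesgue (R ` box l u)" 
    using \<open>R -` box l u \<in> sets borel\<close> im by simp
  also have "\<dots> = emeasure lebesgue (box l u)"
    by (simp add: emeasure_eq_measure2 \<open>R ` box l u \<in> lmeasurable\<close> \<open>measure lebesgue (R ` box l u) = measure lebesgue (box l u)\<close>)
  also have "\<dots> = (\<Prod>b\<in>Basis. (u - l) \<bullet> b)" using le by (simp add: emeasure_lborel_box)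
  finally show "emeasure (distr lborel borel R) (box l u) = (\<Prod>b\<in>Basis. (u - l) \<bullet> b)" .
qed simp

text \<open>The Gaussian density depends on \<open>x\<^sup>2 + y\<^sup>2\<close> only, and reflections preserve both this quantity and
Lebesgue measure. So the coordinates with respect to any orthonormal basis that is
obtained in this way are independent standard normal variables.\<close>

lemma has_bochner_integral_std_gaussian_reflection:
  fixes f :: "real \<times> real \<Rightarrow> real"
  assumes pq: "p\<^sup>2 + q\<^sup>2 = 1" and f: "has_bochner_integral std_normal_pair f r"
  shows "has_bochner_integral (std_gaussian :: (real^2) measure)
    (\<lambda>z. f (p * z$1 + q * z$2, q * z$1 - p * z$2)) r"
proof -
  define R where "R = (\<lambda>z :: real^2. vector [p * z$1 + q * z$2, q * z$1 - p * z$2] :: real^2)"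
  define g where "g = (\<lambda>z :: real^2. ennreal (\<Prod>b\<in>Basis. std_normal_density (z \<bullet> b)))"
  have [measurable]: "R \<in> borel_measurable borel" unfolding R_def by measurable
  have [measurable]: "g \<in> borel_measurable borel" unfolding g_def by measurable
  have "(p * x + q * y)\<^sup>2 + (q * x - p * y)\<^sup>2 = (p\<^sup>2 + q\<^sup>2) * (x\<^sup>2 + y\<^sup>2)" for x y
    by (simp add: algebra_simps power2_eq_square)
  hence n: "(p * x + q * y)\<^sup>2 + (q * x - p * y)\<^sup>2 = x\<^sup>2 + y\<^sup>2" for x y
    using pq by simp
  have g: "g z = ennreal (1 / (2 * pi) * exp (- ((z$1)\<^sup>2 + (z$2)\<^sup>2) / 2))" for z
    by (simp add: g_def prod_Basis_real2 inner_axis std_normal_density_def field_simps flip: exp_add)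
  have gR: "g (R z) = g z" for z unfolding g by (simp add: R_def n)
  have "distr std_gaussian borel R = (std_gaussian :: (real^2) measure)"
  proof -
    have "std_gaussian = density (distr lborel borel R) g"
      unfolding std_gaussian_def g_def R_def by (simp only: lborel_reflection[OF pq])
    also have "\<dots> = distr (density lborel (\<lambda>z. g (R z))) borel R"
      by (rule density_distr) auto
    also have "(\<lambda>z. g (R z)) = g" by (simp add: gR)
    also have "density lborel g = std_gaussian" by (simp add: std_gaussian_def g_def)
    finally show ?thesis ..
  qed
  hence distr: "has_bochner_integral (distr std_gaussian borel R) (\<lambda>z. f (z$1, z$2)) r"
    using has_bochner_integral_std_gaussian_real2[OF f] by simp
  have "has_bochner_integral std_gaussian (\<lambda>z. f (R z $ 1, R z $ 2)) r"
  proof -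
    have meas: "(\<lambda>z :: real^2. f (z$1, z$2)) \<in> borel_measurable borel"
      using distr by (auto simp: has_bochner_integral_iff dest!: borel_measurable_integrable)
    have R: "R \<in> measurable std_gaussian borel" by (simp add: std_gaussian_def)
    show ?thesis using distr has_bochner_integral_distr_iff[OF R meas] by simp
  qed
  thus ?thesis by (simp add: R_def)
qed

lemma has_bochner_integral_std_normal_pair_mult:
  fixes f g :: "real \<Rightarrow> real"
  assumes f: "has_bochner_integral std_normal_distribution f a" and g: "has_bochner_integral std_normal_distribution g b"
  shows "has_bochner_integral std_normal_pair (\<lambda>z. f (fst z) * g (snd z)) (a * b)"
proof -
  have int: "integrable std_normal_distribution f" "integrable std_normal_distribution g"
    using f g by (auto simp: has_bochner_integral_iff)
  hence [measurable]: "f \<in> borel_measurable borel" "g \<in> borel_measurable borel"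
    by (auto dest: borel_measurable_integrable)
  have "integrable std_normal_pair (\<lambda>z. f (fst z) * g (snd z))"
    by (rule NN.Fubini_integrable)
      (use int in \<open>auto simp: abs_mult intro!: integrable_mult_left integrable_mult_right\<close>)
  thus ?thesis
    using NN.integral_fst'[of "\<lambda>z. f (fst z) * g (snd z)"] f g by (simp add: has_bochner_integral_iff)
qed

lemma std_normal_cdf_minus: "std_normal_cdf (- x) = 1 - std_normal_cdf x"
proof -
  have "distr std_normal_distribution borel uminus = std_normal_distribution"
  proof -
    have "std_normal_distribution = density (distr lborel borel uminus) std_normal_density"
      by (simp add: lborel_distr_uminus)
    also have "\<dots> = distr (density lborel (\<lambda>x. std_normal_density (- x))) borel uminus"
      by (rule density_distr) auto
    finally show ?thesis by (simp add: std_normal_density_def)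
  qed
  hence "std_normal_cdf (- x) = measure (distr std_normal_distribution borel uminus) {..- x}"
    by (simp add: cdf_def)
  also have "\<dots> = measure std_normal_distribution {x..}"
    by (subst measure_distr) (auto simp: vimage_def atLeast_def)
  also have "{x..} = UNIV - {..x} \<union> {x}" by auto
  also have "measure std_normal_distribution \<dots> = measure std_normal_distribution (UNIV - {..x})"
    by (subst measure_Un_null_set) (auto simp: null_sets_def emeasure_density)
  also have "\<dots> = 1 - std_normal_cdf x"
    using N.prob_compl[of "{..x}"] by (simp add: cdf_def)
  finally show ?thesis .
qed

lemma std_normal_cdf_0: "std_normal_cdf 0 = 1 / 2"
  using std_normal_cdf_minus[of 0] by simp

lemma measure_std_normal:
  shows measure_std_normal_atMost: "measure std_normal_distribution {..x} = std_normal_cdf x"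
    and measure_std_normal_lessThan: "measure std_normal_distribution {..<x} = std_normal_cdf x"
    and measure_std_normal_greaterThan: "measure std_normal_distribution {x<..} = 1 - std_normal_cdf x"
    and measure_std_normal_atLeast: "measure std_normal_distribution {x..} = 1 - std_normal_cdf x"
    and measure_std_normal_Icc: "a \<le> b \<Longrightarrow> measure std_normal_distribution {a..b} = std_normal_cdf b - std_normal_cdf a"
    and measure_std_normal_Ico: "a \<le> b \<Longrightarrow> measure std_normal_distribution {a..<b} = std_normal_cdf b - std_normal_cdf a"
    and measure_std_normal_Ioo: "a \<le> b \<Longrightarrow> measure std_normal_distribution {a<..<b} = std_normal_cdf b - std_normal_cdf a"
proof -
  have insert: "measure std_normal_distribution (insert y A) = measure std_normal_distribution A"
    if "A \<in> sets borel" for y A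
    using measure_Un_null_set[of A std_normal_distribution "{y}"] that
    by (simp add: null_sets_def emeasure_density)
  show m1: "measure std_normal_distribution {..x} = std_normal_cdf x" for x by (simp add: cdf_def)
  show "measure std_normal_distribution {..<x} = std_normal_cdf x"
    using insert[of "{..<x}" x] m1[of x] by (simp add: ivl_disj_un_singleton(2)[symmetric])
  show m2: "measure std_normal_distribution {x<..} = 1 - std_normal_cdf x"
    using N.prob_compl[of "{..x}"] by (simp add: cdf_def Compl_eq_Diff_UNIV[symmetric])
  show "measure std_normal_distribution {x..} = 1 - std_normal_cdf x"
    using insert[of "{x<..}" x] m2 by (simp add: ivl_disj_un_singleton(1)[symmetric])
  have 1: "measure std_normal_distribution {a<..b} = std_normal_cdf b - std_normal_cdf a" if "a \<le> b" for a b
    using that by (cases "a = b") (auto simp: N.cdf_diff_eq)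
  have 2: "measure std_normal_distribution {a<..<b} = std_normal_cdf b - std_normal_cdf a" if "a \<le> b" for a b
    using insert[of "{a<..<b}" b] 1[of a b] that
    by (cases "a = b") (auto simp: ivl_disj_un_singleton(4)[symmetric])
  show "measure std_normal_distribution {a<..<b} = std_normal_cdf b - std_normal_cdf a" if "a \<le> b"
    using 2 that by auto
  show "measure std_normal_distribution {a..<b} = std_normal_cdf b - std_normal_cdf a" if "a \<le> b"
    using insert[of "{a<..<b}" a] 2[of a b] that
    by (cases "a = b") (auto simp: ivl_disj_un_singleton(3)[symmetric])
  show "measure std_normal_distribution {a..b} = std_normal_cdf b - std_normal_cdf a" if "a \<le> b"
    using insert[of "{a<..b}" a] 1[of a b] that
    by (cases "a = b") (auto simp: ivl_disj_un_singleton(5)[symmetric])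
qed

lemma has_bochner_integral_std_normal_indicator:
  assumes "S \<in> sets borel"
  shows "has_bochner_integral std_normal_distribution (indicator S) (measure std_normal_distribution S)"
  using assms by (simp add: has_bochner_integral_iff N.emeasure_eq_measure)

lemma std_normal_cdf_diff_integral:
  assumes "a \<le> b"
  shows "has_bochner_integral lborel (\<lambda>x. std_normal_density x * indicator {a..b} x)
           (std_normal_cdf b - std_normal_cdf a)"
proof -
  have "(\<integral>x. std_normal_density x * indicator {a..b} x \<partial>lborel)
      = (\<integral>x. indicator {a..b} x \<partial>std_normal_distribution)"
    by (subst integral_density) auto
  also have "\<dots> = std_normal_cdf b - std_normal_cdf a"
    using measure_std_normal_Icc[OF assms] by simp
  finally show ?thesis
    by (auto simp: has_bochner_integral_iff intro!: integrable_real_mult_indicator)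
qed

lemma DERIV_std_normal_density:
  "(std_normal_density has_real_derivative (- x * std_normal_density x)) (at x within A)"
  unfolding std_normal_density_def by (auto intro!: derivative_eq_intros simp: field_simps)

text \<open>This is integration by parts: \<open>x \<mapsto> - x * std_normal_density x\<close> is a primitive of
\<open>(x\<^sup>2 - 1) * std_normal_density x\<close>.\<close>

lemma has_bochner_integral_square_std_normal_Icc:
  assumes "0 \<le> a"
  shows "has_bochner_integral std_normal_distribution (\<lambda>x. x\<^sup>2 * indicator {0..a} x) (trunc_moment2 a)"
proof -
  have "has_bochner_integral lborel (\<lambda>x. (x\<^sup>2 * std_normal_density x - std_normal_density x) * indicator {0..a} x)
     (- a * std_normal_density a - (- 0 * std_normal_density 0))"
    by (rule has_bochner_integral_FTC_Icc_real[OF assms])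
       (auto intro!: derivative_eq_intros DERIV_std_normal_density continuous_intros
         DERIV_isCont[OF DERIV_std_normal_density] simp: power2_eq_square)
  from has_bochner_integral_add[OF this std_normal_cdf_diff_integral[OF assms]]
  have "has_bochner_integral lborel (\<lambda>x. std_normal_density x * (x\<^sup>2 * indicator {0..a} x)) (trunc_moment2 a)"
    by (simp add: algebra_simps trunc_moment2_def std_normal_cdf_0)
  thus ?thesis by (auto simp: has_bochner_integral_iff integral_density integrable_density)
qed

lemma AE_std_normal_neq: "AE x in std_normal_distribution. x \<noteq> c"
  using AE_lborel_singleton[of c] by (auto simp: AE_density elim!: eventually_mono)

text \<open>The end points are null sets, so the same value holds for open and half-open intervals.\<close>

lemma has_bochner_integral_square_std_normal:
  assumes "0 \<le> a" "{0<..<a} \<subseteq> S" "S \<subseteq> {0..a}" "S \<in> sets borel"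
  shows "has_bochner_integral std_normal_distribution (\<lambda>x. x\<^sup>2 * indicator S x) (trunc_moment2 a)"
proof -
  note [measurable] = assms(4)
  have AE: "AE x in std_normal_distribution. x\<^sup>2 * indicator {0..a} x = (x\<^sup>2 * indicator S x :: real)"
    using AE_std_normal_neq[of 0] AE_std_normal_neq[of a]
    by eventually_elim (use assms in \<open>auto split: split_indicator simp: subset_eq\<close>)
  show ?thesis
    using has_bochner_integral_square_std_normal_Icc[OF assms(1)] integrable_cong_AE[OF _ _ AE]
      integral_cong_AE[OF _ _ AE] by (auto simp: has_bochner_integral_iff)
qed

section \<open>Gaussian integrals over a wedge\<close>

lemma nn_integral_continuous_Icc:
  fixes g :: "real \<Rightarrow> real"
  assumes "continuous_on {a..b} g" "\<And>x. x \<in> {a..b} \<Longrightarrow> 0 \<le> g x"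
  shows "(\<integral>\<^sup>+x. ennreal (g x) * indicator {a..b} x \<partial>lborel) = ennreal (integral {a..b} g)"
proof -
  have int: "set_integrable lborel {a..b} g"
    by (intro borel_integrable_atLeastAtMost' assms)
  have "(\<integral>\<^sup>+x. ennreal (g x) * indicator {a..b} x \<partial>lborel)
      = (\<integral>\<^sup>+x. ennreal (indicator {a..b} x *\<^sub>R g x) \<partial>lborel)"
    by (intro nn_integral_cong) (auto split: split_indicator)
  also have "\<dots> = ennreal (LINT x:{a..b}|lborel. g x)"
    unfolding set_lebesgue_integral_def using int assms
    by (intro nn_integral_eq_integral) (auto simp: set_integrable_def split: split_indicator)
  also have "(LINT x:{a..b}|lborel. g x) = integral {a..b} g"
    by (rule set_borel_integral_eq_integral[OF int])
  finally show ?thesis .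
qed

text \<open>The cone between the two edges of the triangle at the origin.\<close>

definition wedge :: "real \<Rightarrow> (real \<times> real) set" where
  "wedge k = {z. 0 \<le> fst z \<and> fst z \<le> k * snd z}"

lemma wedge_measurable [measurable]: "wedge k \<in> sets (borel \<Otimes>\<^sub>M borel)"
proof -
  have "Measurable.pred (borel \<Otimes>\<^sub>M borel) (\<lambda>z :: real \<times> real. 0 \<le> fst z \<and> fst z \<le> k * snd z)"
    by measurable
  thus ?thesis by (simp add: pred_def wedge_def space_pair_measure)
qed

text \<open>Integrating over slopes \<open>t = x / y\<close> replaces the wedge by a rectangle. The factor \<open>y\<close> is the Jacobian, and
the quadratic form in the exponent becomes \<open>(1 + t\<^sup>2) y\<^sup>2\<close>. Compared with polar coordinates, this avoids
trigonometric functions in the integrand.\<close>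

lemma nn_integral_std_normal_pair_wedge:
  fixes f :: "real \<times> real \<Rightarrow> real"
  assumes [measurable]: "f \<in> borel_measurable (borel \<Otimes>\<^sub>M borel)" and nn: "\<And>z. 0 \<le> f z"
    and pos: "\<And>x y. y \<le> 0 \<Longrightarrow> f (x, y) = 0"
  shows "(\<integral>\<^sup>+z. ennreal (f z * indicator (wedge k) z) \<partial>std_normal_pair)
    = (\<integral>\<^sup>+t. (\<integral>\<^sup>+y. ennreal (f (t * y, y) * (y * exp (- (1 + t\<^sup>2) * y\<^sup>2 / 2) / (2 * pi))) \<partial>lborel)
        * indicator {0..k} t \<partial>lborel)"
proof -
  define G where "G = (\<lambda>z. f z * indicator (wedge k) z * (exp (- ((fst z)\<^sup>2 + (snd z)\<^sup>2) / 2) / (2 * pi)))"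
  have [measurable]: "G \<in> borel_measurable (borel \<Otimes>\<^sub>M borel)" unfolding G_def by measurable
  have dens: "std_normal_density x * std_normal_density y = exp (- (x\<^sup>2 + y\<^sup>2) / 2) / (2 * pi)" for x y
    by (simp add: std_normal_density_def field_simps flip: exp_add)
  have "(\<integral>\<^sup>+z. ennreal (f z * indicator (wedge k) z) \<partial>std_normal_pair)
      = (\<integral>\<^sup>+z. ennreal (G z) \<partial>(lborel \<Otimes>\<^sub>M lborel))"
    unfolding std_normal_pair_density
    by (subst nn_integral_density) (auto simp: G_def dens nn mult_ac ennreal_mult'[symmetric] intro!: nn_integral_cong)
  also have "\<dots> = (\<integral>\<^sup>+y. (\<integral>\<^sup>+x. ennreal (G (x, y)) \<partial>lborel) \<partial>lborel)"
    by (subst lborel_pair.nn_integral_snd) auto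
  also have "\<dots> = (\<integral>\<^sup>+y. (\<integral>\<^sup>+t. ennreal (f (t * y, y) * (y * exp (- (1 + t\<^sup>2) * y\<^sup>2 / 2) / (2 * pi)))
        * indicator {0..k} t \<partial>lborel) \<partial>lborel)"
  proof (rule nn_integral_cong)
    fix y :: real
    show "(\<integral>\<^sup>+x. ennreal (G (x, y)) \<partial>lborel) = (\<integral>\<^sup>+t. ennreal (f (t * y, y) * (y * exp (- (1 + t\<^sup>2) * y\<^sup>2 / 2) / (2 * pi)))
        * indicator {0..k} t \<partial>lborel)"
    proof (cases "y > 0")
      case False
      thus ?thesis by (simp add: G_def pos)
    next
      case True
      have "(\<integral>\<^sup>+x. ennreal (G (x, y)) \<partial>lborel) = y * (\<integral>\<^sup>+t. ennreal (G (0 + y * t, y)) \<partial>lborel)"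
        using True by (subst nn_integral_real_affine[where c = y and t = 0]) auto
      also have "\<dots> = (\<integral>\<^sup>+t. y * ennreal (G (0 + y * t, y)) \<partial>lborel)"
        by (rule nn_integral_cmult[symmetric]) auto
      also have "\<dots> = (\<integral>\<^sup>+t. ennreal (f (t * y, y) * (y * exp (- (1 + t\<^sup>2) * y\<^sup>2 / 2) / (2 * pi)))
        * indicator {0..k} t \<partial>lborel)"
      proof (rule nn_integral_cong)
        fix t :: real
        have "(y * t, y) \<in> wedge k \<longleftrightarrow> t \<in> {0..k}"
          using True by (auto simp: wedge_def zero_le_mult_iff mult.commute)
        moreover have "- ((y * t)\<^sup>2 + y\<^sup>2) / 2 = - (1 + t\<^sup>2) * y\<^sup>2 / 2"
          by (simp add: algebra_simps power2_eq_square)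
        hence "G (0 + y * t, y) = f (t * y, y) * indicator (wedge k) (y * t, y)
            * (exp (- (1 + t\<^sup>2) * y\<^sup>2 / 2) / (2 * pi))"
          unfolding G_def by (simp only: fst_conv snd_conv add_0_left) (simp only: mult.commute)
        ultimately show "y * ennreal (G (0 + y * t, y)) = ennreal (f (t * y, y) * (y * exp (- (1 + t\<^sup>2) * y\<^sup>2 / 2) / (2 * pi)))
        * indicator {0..k} t"
          using True by (auto simp: mult_ac ennreal_mult'[symmetric] split: split_indicator)
      qed
      finally show ?thesis .
    qed
  qed
  also have "\<dots> = (\<integral>\<^sup>+t. (\<integral>\<^sup>+y. ennreal (f (t * y, y) * (y * exp (- (1 + t\<^sup>2) * y\<^sup>2 / 2) / (2 * pi)))
        * indicator {0..k} t \<partial>lborel) \<partial>lborel)"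
    by (rule lborel_pair.Fubini') measurable
  also have "\<dots> = (\<integral>\<^sup>+t. (\<integral>\<^sup>+y. ennreal (f (t * y, y) * (y * exp (- (1 + t\<^sup>2) * y\<^sup>2 / 2) / (2 * pi))) \<partial>lborel)
        * indicator {0..k} t \<partial>lborel)"
    by (intro nn_integral_cong nn_integral_multc) measurable
  finally show ?thesis .
qed

lemma one_plus_square_pos [simp]: "0 < 1 + (t::real)\<^sup>2" "1 + (t::real)\<^sup>2 \<noteq> 0"
proof -
  show "0 < 1 + t\<^sup>2" by (simp add: add_pos_nonneg)
  thus "1 + t\<^sup>2 \<noteq> 0" by simp
qed

lemma owen_T_integrable: "(\<lambda>x. exp (- h\<^sup>2 * (1 + x\<^sup>2) / 2) / (1 + x\<^sup>2)) integrable_on {0..k::real}"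
  by (intro integrable_continuous_real continuous_intros) auto

lemma owen_T_nonneg: "0 \<le> owen_T h k"
  unfolding owen_T_def
  by (intro mult_nonneg_nonneg integral_nonneg owen_T_integrable) auto

text \<open>For fixed slope \<open>t\<close>, the function \<open>y * exp (- (1 + t\<^sup>2) * y\<^sup>2 / 2)\<close> has an elementary primitive, and its integral
from \<open>h\<close> to infinity is the integrand in the definition of Owen's function up to a constant.\<close>

lemma has_bochner_integral_wedge_owen_T:
  assumes "0 \<le> h"
  shows "has_bochner_integral std_normal_pair
    (\<lambda>z. indicator {h<..} (snd z) * indicator (wedge k) z) (owen_T h k)"
proof (rule has_bochner_integral_nn_integral)
  have inner: "(\<integral>\<^sup>+y. ennreal (indicator {h<..} y * (y * exp (- (1 + t\<^sup>2) * y\<^sup>2 / 2) / (2 * pi))) \<partial>lborel)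
      = ennreal (1 / (2 * pi) * (exp (- h\<^sup>2 * (1 + t\<^sup>2) / 2) / (1 + t\<^sup>2)))" for t
  proof -
    define q where "q = 1 + t\<^sup>2"
    have q: "q > 0" by (simp add: q_def)
    have "(\<integral>\<^sup>+y. ennreal (indicator {h<..} y * (y * exp (- q * y\<^sup>2 / 2) / (2 * pi))) \<partial>lborel)
      = (\<integral>\<^sup>+y. ennreal (y * exp (- q * y\<^sup>2 / 2) / (2 * pi)) * indicator {h..} y \<partial>lborel)"
      using AE_lborel_singleton[of h]
      by (intro nn_integral_cong_AE) (auto split: split_indicator elim!: eventually_mono)
    also have "\<dots> = ennreal (0 - (- (exp (- q * h\<^sup>2 / 2) / q / (2 * pi))))"
    proof (rule nn_integral_FTC_atLeast)
      fix y assume y: "h \<le> y"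
      show "((\<lambda>y. - (exp (- q * y\<^sup>2 / 2) / q / (2 * pi))) has_real_derivative
         (y * exp (- q * y\<^sup>2 / 2) / (2 * pi))) (at y)"
        using q by (auto intro!: derivative_eq_intros simp: field_simps)
      show "0 \<le> y * exp (- q * y\<^sup>2 / 2) / (2 * pi)" using y assms by simp
    next
      show "((\<lambda>y. - (exp (- q * y\<^sup>2 / 2) / q / (2 * pi))) \<longlongrightarrow> 0) at_top"
        using q by real_asymp
    qed auto
    also have "0 - (- (exp (- q * h\<^sup>2 / 2) / q / (2 * pi))) = 1 / (2 * pi) * (exp (- h\<^sup>2 * q / 2) / q)"
      by (simp add: mult.commute)
    finally show ?thesis unfolding q_def .
  qed
  have "(\<integral>\<^sup>+z. ennreal (indicator {h<..} (snd z) * indicator (wedge k) z) \<partial>std_normal_pair)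
    = (\<integral>\<^sup>+t. ennreal (1 / (2 * pi) * (exp (- h\<^sup>2 * (1 + t\<^sup>2) / 2) / (1 + t\<^sup>2))) * indicator {0..k} t \<partial>lborel)"
    by (subst nn_integral_std_normal_pair_wedge; (simp only: snd_conv inner)?; use assms in auto)
  also have "\<dots> = ennreal (integral {0..k} (\<lambda>t. 1 / (2 * pi) * (exp (- h\<^sup>2 * (1 + t\<^sup>2) / 2) / (1 + t\<^sup>2))))"
    by (intro nn_integral_continuous_Icc continuous_intros) auto
  finally show "(\<integral>\<^sup>+z. ennreal (indicator {h<..} (snd z) * indicator (wedge k) z) \<partial>std_normal_pair)
    = ennreal (owen_T h k)"
    unfolding owen_T_def Henstock_Kurzweil_Integration.integral_mult_right .
qed (auto simp: owen_T_nonneg)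

lemma integral_std_normal_density_scaled:
  assumes "0 \<le> h" "0 \<le> k"
  shows "integral {0..k} (\<lambda>t. h * std_normal_density (h * t)) = std_normal_cdf (k * h) - 1 / 2"
proof (cases "h = 0")
  case True thus ?thesis by (simp add: std_normal_cdf_0)
next
  case False
  hence h: "h > 0" using assms by simp
  have int: "set_integrable lborel {0..k} (\<lambda>t. h * std_normal_density (h * t))"
    by (intro borel_integrable_atLeastAtMost' continuous_intros) (auto simp: std_normal_density_def intro!: continuous_intros)
  have "std_normal_cdf (k * h) - 1 / 2 = (\<integral>x. std_normal_density x * indicator {0..k * h} x \<partial>lborel)"
    using std_normal_cdf_diff_integral[of 0 "k * h"] assms
    by (simp add: has_bochner_integral_iff std_normal_cdf_0)
  also have "\<dots> = h * (\<integral>t. std_normal_density (h * t) * indicator {0..k * h} (h * t) \<partial>lborel)"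
    using h by (subst lborel_integral_real_affine[where c = h and t = 0]) auto
  also have "\<dots> = (LINT t:{0..k}|lborel. h * std_normal_density (h * t))"
    unfolding set_lebesgue_integral_def integral_mult_right_zero[symmetric]
    using h by (intro Bochner_Integration.integral_cong)
       (auto split: split_indicator simp: zero_le_mult_iff mult.commute)
  also have "\<dots> = integral {0..k} (\<lambda>t. h * std_normal_density (h * t))"
    by (rule set_borel_integral_eq_integral[OF int])
  finally show ?thesis ..
qed

text \<open>With \<open>q = 1 + t\<^sup>2\<close>, the inner integral over \<open>y \<in> (0, h]\<close> has the integrand \<open>q * y ^ 3 * exp (- q * y\<^sup>2 / 2)\<close>
up to the factor \<open>1 / (2 * pi)\<close>, whose primitive is \<open>- (y\<^sup>2 + 2 / q) * exp (- q * y\<^sup>2 / 2)\<close>. The three terms of the difference of its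
boundary values integrate over the slope to \<open>arctan\<close>, to Owen's function and to a normal probability.\<close>

lemma has_bochner_integral_wedge_square:
  assumes "0 \<le> h" "0 \<le> k"
  shows "has_bochner_integral std_normal_pair
    (\<lambda>z. ((fst z)\<^sup>2 + (snd z)\<^sup>2) * indicator {0<..h} (snd z) * indicator (wedge k) z)
    (arctan k / pi - 2 * owen_T h k - h * std_normal_density h * (std_normal_cdf (k * h) - 1 / 2))"
    (is "has_bochner_integral _ _ ?r")
proof (rule has_bochner_integral_nn_integral)
  \<comment> \<open>\<open>g t\<close> is the value of the inner integral at slope \<open>t\<close>.\<close>
  define g where "g = (\<lambda>t. (2 / (1 + t\<^sup>2) - (h\<^sup>2 + 2 / (1 + t\<^sup>2)) * exp (- h\<^sup>2 * (1 + t\<^sup>2) / 2)) / (2 * pi))"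
  have inner: "(\<integral>\<^sup>+y. ennreal (((t * y)\<^sup>2 + y\<^sup>2) * indicator {0<..h} y * (y * exp (- (1 + t\<^sup>2) * y\<^sup>2 / 2) / (2 * pi))) \<partial>lborel)
      = ennreal (g t)"
    and g_nonneg: "0 \<le> g t" for t
  proof -
    define q where "q = 1 + t\<^sup>2"
    have q: "q > 0" by (simp add: q_def)
    have q': "(t * y)\<^sup>2 + y\<^sup>2 = q * y\<^sup>2" for y by (simp add: q_def algebra_simps power2_eq_square)
    define F where "F = (\<lambda>y. - ((y\<^sup>2 + 2 / q) * exp (- q * y\<^sup>2 / 2)) / (2 * pi))"
    have DF: "(F has_real_derivative (q * y ^ 3 * exp (- q * y\<^sup>2 / 2) / (2 * pi))) (at y)" for y
      unfolding F_def using q by (auto intro!: derivative_eq_intros simp: field_simps power3_eq_cube power2_eq_square)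
    have gF: "g t = F h - F 0" unfolding g_def q_def[symmetric] F_def
      by (simp add: mult.commute diff_divide_distrib)
    have "F 0 \<le> F h"
      by (rule DERIV_nonneg_imp_nondecreasing[OF assms(1)]) (use DF q in \<open>force intro!: exI\<close>)
    thus "0 \<le> g t" by (simp add: gF)
    have "(\<integral>\<^sup>+y. ennreal (((t * y)\<^sup>2 + y\<^sup>2) * indicator {0<..h} y * (y * exp (- q * y\<^sup>2 / 2) / (2 * pi))) \<partial>lborel)
      = (\<integral>\<^sup>+y. ennreal (q * y ^ 3 * exp (- q * y\<^sup>2 / 2) / (2 * pi)) * indicator {0..h} y \<partial>lborel)"
      unfolding q' by (intro nn_integral_cong) (auto split: split_indicator simp: power3_eq_cube power2_eq_square mult_ac)
    also have "\<dots> = ennreal (F h - F 0)"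
      by (rule nn_integral_FTC_Icc) (use DF q assms in auto)
    finally show "(\<integral>\<^sup>+y. ennreal (((t * y)\<^sup>2 + y\<^sup>2) * indicator {0<..h} y * (y * exp (- (1 + t\<^sup>2) * y\<^sup>2 / 2) / (2 * pi))) \<partial>lborel)
      = ennreal (g t)" by (simp add: gF q_def)
  qed
  have cont: "continuous_on {0..k} g" unfolding g_def by (intro continuous_intros) auto
  have "integral {0..k} g = ?r"
  proof -
    have i1: "((\<lambda>t. 1 / pi * (1 / (1 + t\<^sup>2))) has_integral 1 / pi * (arctan k - arctan 0)) {0..k}"
      using assms(2) by (intro has_integral_mult_right fundamental_theorem_of_calculus)
        (auto intro!: derivative_eq_intros simp: has_real_derivative_iff_has_vector_derivative[symmetric] field_simps)
    have i2: "((\<lambda>t. 2 * (1 / (2 * pi) * (exp (- h\<^sup>2 * (1 + t\<^sup>2) / 2) / (1 + t\<^sup>2)))) has_integral 2 * owen_T h k) {0..k}"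
      unfolding owen_T_def
      by (intro has_integral_mult_right integrable_integral integrable_continuous_real continuous_intros) auto
    have "continuous_on {0..k} (\<lambda>t. h * std_normal_density (h * t))"
      unfolding std_normal_density_def by (intro continuous_intros) auto
    hence i3: "((\<lambda>t. h * std_normal_density h * (h * std_normal_density (h * t))) has_integral
      h * std_normal_density h * (std_normal_cdf (k * h) - 1 / 2)) {0..k}"
      unfolding integral_std_normal_density_scaled[OF assms, symmetric]
      by (intro has_integral_mult_right integrable_integral integrable_continuous_real)
    have "g t = 1 / pi * (1 / (1 + t\<^sup>2)) - 2 * (1 / (2 * pi) * (exp (- h\<^sup>2 * (1 + t\<^sup>2) / 2) / (1 + t\<^sup>2)))
      - h * std_normal_density h * (h * std_normal_density (h * t))" for t
    proof -
      have "exp (- h\<^sup>2 * (1 + t\<^sup>2) / 2) = exp (- h\<^sup>2 / 2) * exp (- (h * t)\<^sup>2 / 2)"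
      proof -
        have "- h\<^sup>2 * (1 + t\<^sup>2) / 2 = - h\<^sup>2 / 2 + - (h * t)\<^sup>2 / 2"
          by (simp add: field_simps power_mult_distrib)
        thus ?thesis by (simp only: exp_add)
      qed
      moreover have "h * std_normal_density h * (h * std_normal_density (h * t))
         = h\<^sup>2 * (exp (- h\<^sup>2 / 2) * exp (- (h * t)\<^sup>2 / 2)) / (2 * pi)"
        by (simp add: std_normal_density_def power2_eq_square)
      ultimately have "h * std_normal_density h * (h * std_normal_density (h * t))
         = h\<^sup>2 * exp (- h\<^sup>2 * (1 + t\<^sup>2) / 2) / (2 * pi)" by simp
      moreover have "(2 / q - (H + 2 / q) * X) / (2 * pi)
          = 1 / pi * (1 / q) - 2 * (1 / (2 * pi) * (X / q)) - H * X / (2 * pi)" if "q > 0" for q H X :: real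
        using that by (simp add: field_simps)
      ultimately show ?thesis unfolding g_def using one_plus_square_pos(1)[of t] by presburger
    qed
    hence "g = (\<lambda>t. 1 / pi * (1 / (1 + t\<^sup>2)) - 2 * (1 / (2 * pi) * (exp (- h\<^sup>2 * (1 + t\<^sup>2) / 2) / (1 + t\<^sup>2)))
      - h * std_normal_density h * (h * std_normal_density (h * t)))" by blast
    hence "(g has_integral (1 / pi * (arctan k - arctan 0) - 2 * owen_T h k
       - h * std_normal_density h * (std_normal_cdf (k * h) - 1 / 2))) {0..k}"
      using has_integral_diff[OF has_integral_diff[OF i1 i2] i3] by simp
    thus ?thesis by (simp add: integral_unique)
  qed
  moreover have "0 \<le> integral {0..k} g"
    by (intro integral_nonneg integrable_continuous_real cont) (simp add: g_nonneg)
  ultimately show "0 \<le> ?r" by simp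
  have "(\<integral>\<^sup>+z. ennreal (((fst z)\<^sup>2 + (snd z)\<^sup>2) * indicator {0<..h} (snd z) * indicator (wedge k) z) \<partial>std_normal_pair)
     = (\<integral>\<^sup>+t. ennreal (g t) * indicator {0..k} t \<partial>lborel)"
    by (subst nn_integral_std_normal_pair_wedge; (simp only: fst_conv snd_conv inner)?; auto)
  also have "\<dots> = ennreal (integral {0..k} g)"
    by (intro nn_integral_continuous_Icc cont g_nonneg)
  finally show "(\<integral>\<^sup>+z. ennreal (((fst z)\<^sup>2 + (snd z)\<^sup>2) * indicator {0<..h} (snd z) * indicator (wedge k) z) \<partial>std_normal_pair)
     = ennreal ?r" using \<open>integral {0..k} g = ?r\<close> by simp
qed auto

section \<open>Closed forms at unit noise\<close>

text \<open>The closed forms in the parameters of the dilated sets: \<open>h\<close> is the height and \<open>k\<close> the slope \<open>x / y\<close> of the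
long edge.\<close>

definition unit_segment_risk :: "real \<Rightarrow> real \<Rightarrow> real" where
  "unit_segment_risk k h = (let a = sqrt (1 + k\<^sup>2) * h in trunc_moment2 a + a\<^sup>2 * (1 - std_normal_cdf a))"

definition unit_triangle_risk :: "real \<Rightarrow> real \<Rightarrow> real" where
  "unit_triangle_risk k h = (let a = sqrt (1 + k\<^sup>2) * h in
      (arctan k / pi - 2 * owen_T h k - h * std_normal_density h * (std_normal_cdf (k * h) - 1 / 2))
      + trunc_moment2 a / 2 + trunc_moment2 h / 2
      + (1 - std_normal_cdf h) * (trunc_moment2 (k * h) + h\<^sup>2 * (std_normal_cdf (k * h) - 1 / 2))
      + h\<^sup>2 * ((1 - std_normal_cdf h) / 2)
      + a\<^sup>2 * ((1 - std_normal_cdf a) / 2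
          + owen_T h k - (std_normal_cdf (k * h) - 1 / 2) * (1 - std_normal_cdf h)))"

lemma ls_risk_unit_segment:
  assumes "k > 0" "h > 0"
  shows "ls_risk 1 0 (convex hull {0, vector [k * h, h] :: real^2}) = unit_segment_risk k h"
proof -
  define a where "a = sqrt (1 + k\<^sup>2) * h"
  have a: "a > 0" "a\<^sup>2 = (k * h)\<^sup>2 + h\<^sup>2"
    using assms by (simp_all add: a_def power_mult_distrib algebra_simps add_pos_nonneg)
  define s where "s = (\<lambda>z :: real^2. (k * h / a) * z$1 + (h / a) * z$2)"
  have pq: "(k * h / a)\<^sup>2 + (h / a)\<^sup>2 = 1"
    unfolding power_divide add_divide_distrib[symmetric] a(2)[symmetric] using a(1) by simp
  have s: "s z = (k * h * z$1 + h * z$2) / a" for z by (simp add: s_def add_divide_distrib)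
  have one: "has_bochner_integral std_normal_distribution (\<lambda>_. 1 :: real) 1"
    using has_bochner_integral_std_normal_indicator[of UNIV] N.prob_space by (simp add: space_density)
  have "has_bochner_integral std_normal_distribution
     (\<lambda>x. x\<^sup>2 * indicator {0<..<a} x + a\<^sup>2 * indicator {a..} x) (trunc_moment2 a + a\<^sup>2 * (1 - std_normal_cdf a))"
    using a(1) unfolding measure_std_normal_atLeast[symmetric]
    by (intro has_bochner_integral_add has_bochner_integral_mult_right
          has_bochner_integral_std_normal_indicator has_bochner_integral_square_std_normal) auto
  from has_bochner_integral_std_gaussian_reflection[OF pq
      has_bochner_integral_std_normal_pair_mult[OF this one]]
  have "has_bochner_integral std_gaussian
     (\<lambda>z. (s z)\<^sup>2 * indicator {0<..<a} (s z) + a\<^sup>2 * indicator {a..} (s z))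
     (trunc_moment2 a + a\<^sup>2 * (1 - std_normal_cdf a))" by (simp add: s_def)
  moreover have "(norm (closest_point (convex hull {0, vector [k * h, h]}) z))\<^sup>2
      = (s z)\<^sup>2 * indicator {0<..<a} (s z) + a\<^sup>2 * indicator {a..} (s z)" for z :: "real^2"
    unfolding s by (rule norm_closest_point_segment) (use assms a in auto)
  ultimately show ?thesis
    by (simp add: ls_risk_def has_bochner_integral_iff unit_segment_risk_def Let_def a_def)
qed

text \<open>Each summand of the decomposition in \<open>norm_closest_point_triangle\<close> is integrated separately: the long
edge and the outer part of the cone at \<open>(k h, h)\<close> in the reflected coordinates \<open>s\<close> and \<open>t\<close>, all others in the
standard ones.\<close>

lemma ls_risk_unit_triangle:
  assumes "k > 0" "h > 0"
  shows "ls_risk 1 0 (convex hull {0, vector [k * h, h] :: real^2, vector [0, h]}) = unit_triangle_risk k h"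
proof -
  define a where "a = sqrt (1 + k\<^sup>2) * h"
  let ?I = "arctan k / pi - 2 * owen_T h k - h * std_normal_density h * (std_normal_cdf (k * h) - 1 / 2)"
  let ?B = "trunc_moment2 a / 2" and ?A = "trunc_moment2 h / 2"
  let ?C = "(1 - std_normal_cdf h) * (trunc_moment2 (k * h) + h\<^sup>2 * (std_normal_cdf (k * h) - 1 / 2))"
  let ?D = "h\<^sup>2 * ((1 - std_normal_cdf h) / 2)"
  let ?V = "a\<^sup>2 * ((1 - std_normal_cdf a) / 2
    + owen_T h k - (std_normal_cdf (k * h) - 1 / 2) * (1 - std_normal_cdf h))"
  have a: "a > 0" "a\<^sup>2 = (k * h)\<^sup>2 + h\<^sup>2"
    using assms by (simp_all add: a_def power_mult_distrib algebra_simps add_pos_nonneg)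
  have kh: "k * h > 0" using assms by simp
  define s where "s = (\<lambda>z :: real^2. (k * h / a) * z$1 + (h / a) * z$2)"
  define t where "t = (\<lambda>z :: real^2. (h / a) * z$1 - (k * h / a) * z$2)"
  have pq: "(k * h / a)\<^sup>2 + (h / a)\<^sup>2 = 1"
    unfolding power_divide add_divide_distrib[symmetric] a(2)[symmetric] using a(1) by simp
  have s: "s z = (k * h * z$1 + h * z$2) / a" for z by (simp add: s_def add_divide_distrib)
  have t: "t z = (h * z$1 - k * h * z$2) / a" for z by (simp add: t_def diff_divide_distrib)
  note ind = has_bochner_integral_std_normal_indicator
  note sq = has_bochner_integral_square_std_normal
  note mult = has_bochner_integral_std_normal_pair_mult
  note rot = has_bochner_integral_std_gaussian_reflection[OF pq]
  note id = has_bochner_integral_std_gaussian_real2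
  have neg: "has_bochner_integral std_normal_distribution (indicator {..<0}) (1 / 2 :: real)"
      "has_bochner_integral std_normal_distribution (indicator {..0}) (1 / 2 :: real)"
      "has_bochner_integral std_normal_distribution (indicator {0<..}) (1 / 2 :: real)"
    using ind[of "{..<0}"] ind[of "{..0}"] ind[of "{0<..}"] by (simp_all add: measure_std_normal std_normal_cdf_0)
  have tail: "has_bochner_integral std_normal_distribution (indicator {x..}) (1 - std_normal_cdf x)"
     "has_bochner_integral std_normal_distribution (indicator {x<..}) (1 - std_normal_cdf x)" for x
    using ind[of "{x..}"] ind[of "{x<..}"] by (simp_all add: measure_std_normal)
  have mid: "has_bochner_integral std_normal_distribution (indicator {0<..<k * h}) (std_normal_cdf (k * h) - 1 / 2)"
    "has_bochner_integral std_normal_distribution (indicator {0..<k * h}) (std_normal_cdf (k * h) - 1 / 2)"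
    using ind[of "{0<..<k * h}"] ind[of "{0..<k * h}"] kh by (simp_all add: measure_std_normal std_normal_cdf_0)
  have I: "has_bochner_integral std_gaussian
     (\<lambda>z :: real^2. ((z$1)\<^sup>2 + (z$2)\<^sup>2) * indicator {0<..h} (z$2) * indicator (wedge k) (z$1, z$2)) ?I"
    using id[OF has_bochner_integral_wedge_square[of h k]] assms by simp
  have B: "has_bochner_integral std_gaussian (\<lambda>z :: real^2. (s z)\<^sup>2 * indicator {0<..<a} (s z) * indicator {0<..} (t z)) ?B"
    using rot[OF mult[OF sq[of a "{0<..<a}"] neg(3)]] a(1) by (simp add: s_def t_def greaterThanLessThan_subseteq_atLeastAtMost_iff)
  have A: "has_bochner_integral std_gaussian (\<lambda>z :: real^2. indicator {..<0} (z$1) * ((z$2)\<^sup>2 * indicator {0<..h} (z$2))) ?A"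
    using id[OF mult[OF neg(1) sq[of h "{0<..h}"]]] assms(2) by (simp add: greaterThanLessThan_subseteq_greaterThanAtMost_iff greaterThanAtMost_subseteq_atLeastAtMost_iff)
  have C: "has_bochner_integral std_gaussian (\<lambda>z :: real^2.
     ((z$1)\<^sup>2 * indicator {0<..<k * h} (z$1) + h\<^sup>2 * indicator {0<..<k * h} (z$1)) * indicator {h<..} (z$2)) ?C"
    using id[OF mult[OF has_bochner_integral_add[OF sq[of "k * h" "{0<..<k * h}"]
       has_bochner_integral_mult_right[OF mid(1), of "h\<^sup>2"]] tail(2)[of h]]] kh
    by (simp add: greaterThanLessThan_subseteq_atLeastAtMost_iff mult.commute)
  have D: "has_bochner_integral std_gaussian (\<lambda>z :: real^2. h\<^sup>2 * (indicator {..0} (z$1) * indicator {h<..} (z$2))) ?D"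
    using has_bochner_integral_mult_right[OF id[OF mult[OF neg(2) tail(2)[of h]]], of "h\<^sup>2"] by simp
  have V: "has_bochner_integral std_gaussian (\<lambda>z :: real^2. a\<^sup>2 * (indicator {a..} (s z) * indicator {0<..} (t z)
       + indicator {h<..} (z$2) * indicator (wedge k) (z$1, z$2)
       - indicator {0..<k*h} (z$1) * indicator {h<..} (z$2))) ?V"
    using has_bochner_integral_mult_right[OF has_bochner_integral_diff[OF has_bochner_integral_add[OF
      rot[OF mult[OF tail(1)[of a] neg(3)]] id[OF has_bochner_integral_wedge_owen_T[of h k]]]
      id[OF mult[OF mid(2) tail(2)[of h]]]], of "a\<^sup>2"] assms(2)
    by (simp add: s_def t_def)
  have "(norm (closest_point (convex hull {0, vector [k * h, h], vector [0, h]}) z))\<^sup>2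
      = ((z$1)\<^sup>2 + (z$2)\<^sup>2) * indicator {0<..h} (z$2) * indicator (wedge k) (z$1, z$2)
      + (s z)\<^sup>2 * indicator {0<..<a} (s z) * indicator {0<..} (t z)
      + indicator {..<0} (z$1) * ((z$2)\<^sup>2 * indicator {0<..h} (z$2))
      + ((z$1)\<^sup>2 * indicator {0<..<k * h} (z$1) + h\<^sup>2 * indicator {0<..<k * h} (z$1)) * indicator {h<..} (z$2)
      + h\<^sup>2 * (indicator {..0} (z$1) * indicator {h<..} (z$2))
      + a\<^sup>2 * (indicator {a..} (s z) * indicator {0<..} (t z)
       + indicator {h<..} (z$2) * indicator (wedge k) (z$1, z$2)
       - indicator {0..<k*h} (z$1) * indicator {h<..} (z$2))" for z :: "real^2"
  proof -
    \<comment> \<open>In the wedge only the origin has height \<open>0\<close>, and there the integrand vanishes.\<close>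
    have "(if 0 \<le> z$1 \<and> z$1 \<le> k * z$2 then ((z$1)\<^sup>2 + (z$2)\<^sup>2) * indicator {..h} (z$2) else 0)
      = ((z$1)\<^sup>2 + (z$2)\<^sup>2) * indicator {0<..h} (z$2) * indicator (wedge k) (z$1, z$2)"
    proof (cases "z$2 > 0")
      case False
      hence "z$2 = 0 \<or> k * z$2 < 0" using assms(1) by (auto simp: mult_less_0_iff)
      thus ?thesis using False by (auto simp: wedge_def indicator_def)
    qed (auto simp: wedge_def indicator_def)
    moreover have "(if 0 \<le> z$1 \<and> z$1 \<le> k * z$2 then indicator {h<..} (z$2) else 0)
      = (indicator {h<..} (z$2) * indicator (wedge k) (z$1, z$2) :: real)"
      by (auto simp: wedge_def indicator_def)
    ultimately show ?thesis
      using norm_closest_point_triangle[OF assms(1,2) a, of z]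
      unfolding s[symmetric] t[symmetric] by (simp only: distrib_right)
  qed
  hence "ls_risk 1 0 (convex hull {0, vector [k * h, h] :: real^2, vector [0, h]})
      = ?I + ?B + ?A + ?C + ?D + ?V"
    using has_bochner_integral_add[OF has_bochner_integral_add[OF has_bochner_integral_add[OF
      has_bochner_integral_add[OF has_bochner_integral_add[OF I B] A] C] D] V]
    by (simp add: ls_risk_def has_bochner_integral_iff)
  thus ?thesis unfolding unit_triangle_risk_def Let_def a_def .
qed

section \<open>Limits of the difference of the unit risks\<close>

lemma std_normal_density_le_1: "std_normal_density x \<le> 1"
proof -
  have "std_normal_density x \<le> 1 / sqrt (2 * pi)" 
    unfolding std_normal_density_def by (intro mult_left_le) auto
  also have "\<dots> \<le> 1" using pi_gt3 by (simp add: real_le_rsqrt)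
  finally show ?thesis .
qed

lemma std_normal_cdf_near_0:
  assumes "0 \<le> x"
  shows "0 \<le> std_normal_cdf x - 1 / 2" "std_normal_cdf x - 1 / 2 \<le> x"
proof -
  show "0 \<le> std_normal_cdf x - 1 / 2"
    using N.cdf_nondecreasing[OF assms] by (simp add: std_normal_cdf_0)
  have "std_normal_cdf x - 1 / 2 = (\<integral>y. std_normal_density y * indicator {0..x} y \<partial>lborel)"
    using std_normal_cdf_diff_integral[OF assms] by (simp add: has_bochner_integral_iff std_normal_cdf_0)
  also have "\<dots> \<le> (\<integral>y. indicator {0..x} y \<partial>lborel)"
    using std_normal_cdf_diff_integral[OF assms] assms
    by (intro integral_mono) (auto simp: has_bochner_integral_iff std_normal_density_le_1 split: split_indicator)
  also have "\<dots> = x" using assms by simp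
  finally show "std_normal_cdf x - 1 / 2 \<le> x" .
qed

text \<open>For \<open>t \<ge> x \<ge> 1\<close> the density \<open>std_normal_density t\<close> is at most \<open>t * std_normal_density t\<close>, which is the derivative of
\<open>- std_normal_density t\<close>.\<close>

lemma std_normal_tail_le:
  assumes "1 \<le> x"
  shows "1 - std_normal_cdf x \<le> std_normal_density x"
proof -
  have "std_normal_cdf y \<le> std_normal_cdf x + std_normal_density x" if y: "x \<le> y" for y
  proof -
    have xphi: "has_bochner_integral lborel (\<lambda>t. t * std_normal_density t * indicator {x..y} t)
       (- std_normal_density y - (- std_normal_density x))"
      by (rule has_bochner_integral_FTC_Icc_real[OF y])
         (auto intro!: derivative_eq_intros DERIV_std_normal_density continuous_intros
           DERIV_isCont[OF DERIV_std_normal_density])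
    have "std_normal_cdf y - std_normal_cdf x = (\<integral>t. std_normal_density t * indicator {x..y} t \<partial>lborel)"
      using std_normal_cdf_diff_integral[OF y] by (simp add: has_bochner_integral_iff)
    also have "\<dots> \<le> (\<integral>t. t * std_normal_density t * indicator {x..y} t \<partial>lborel)"
    proof (rule integral_mono)
      fix t show "std_normal_density t * indicator {x..y} t \<le> t * std_normal_density t * indicator {x..y} t"
        using assms mult_right_mono[of 1 t "std_normal_density t"] by (auto split: split_indicator)
    qed (use std_normal_cdf_diff_integral[OF y] xphi in \<open>auto simp: has_bochner_integral_iff\<close>)
    also have "\<dots> \<le> std_normal_density x"
      using xphi by (simp add: has_bochner_integral_iff)
    finally show ?thesis by simp
  qed
  hence "eventually (\<lambda>y. std_normal_cdf y \<le> std_normal_cdf x + std_normal_density x) at_top"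
    by (rule eventually_mono[OF eventually_ge_at_top[of x]])
  from tendsto_upperbound[OF N.cdf_lim_at_top_prob this] show ?thesis by simp
qed

lemma trunc_moment2_bounds:
  assumes "0 \<le> x"
  shows "0 \<le> trunc_moment2 x" "trunc_moment2 x \<le> x\<^sup>2 * (std_normal_cdf x - 1 / 2)"
proof -
  note m = has_bochner_integral_square_std_normal_Icc[OF assms]
  have "trunc_moment2 x = (\<integral>y. y\<^sup>2 * indicator {0..x} y \<partial>std_normal_distribution)"
    using m by (simp add: has_bochner_integral_iff)
  also have "\<dots> \<ge> 0" by (intro integral_nonneg_AE) auto
  finally show "0 \<le> trunc_moment2 x" .
  have c: "has_bochner_integral std_normal_distribution (\<lambda>y. x\<^sup>2 * indicator {0..x} y) (x\<^sup>2 * (std_normal_cdf x - 1 / 2))"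
    using has_bochner_integral_mult_right[OF has_bochner_integral_std_normal_indicator[of "{0..x}"], of "x\<^sup>2"] assms
    by (simp add: measure_std_normal std_normal_cdf_0)
  have "(\<integral>y. y\<^sup>2 * indicator {0..x} y \<partial>std_normal_distribution)
     \<le> (\<integral>y. x\<^sup>2 * indicator {0..x} y \<partial>std_normal_distribution)"
    using m c by (intro integral_mono) (auto simp: has_bochner_integral_iff power_mono split: split_indicator)
  thus "trunc_moment2 x \<le> x\<^sup>2 * (std_normal_cdf x - 1 / 2)"
    unfolding has_bochner_integral_integral_eq[OF m] has_bochner_integral_integral_eq[OF c] .
qed

text \<open>Read off from the integral that the closed form represents: the truncated wedge lies in the rectangle
\<open>[0, k h] \<times> [0, h]\<close>, on which the integrand is at most \<open>(1 + k\<^sup>2) h\<^sup>2\<close>. This gives the order in \<open>h\<close> near \<open>0\<close>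
without expanding the closed form.\<close>

lemma wedge_square_bounds:
  assumes "0 \<le> h" "0 \<le> k"
  defines "I \<equiv> arctan k / pi - 2 * owen_T h k - h * std_normal_density h * (std_normal_cdf (k * h) - 1 / 2)"
  shows "0 \<le> I" "I \<le> (1 + k\<^sup>2) * h\<^sup>2 * ((std_normal_cdf (k * h) - 1 / 2) * (std_normal_cdf h - 1 / 2))"
proof -
  note m = has_bochner_integral_wedge_square[OF assms(1,2), folded I_def]
  have "I = (\<integral>z. ((fst z)\<^sup>2 + (snd z)\<^sup>2) * indicator {0<..h} (snd z) * indicator (wedge k) z \<partial>std_normal_pair)"
    using m by (simp add: has_bochner_integral_iff)
  also have "\<dots> \<ge> 0" by (intro integral_nonneg_AE) auto
  finally show "0 \<le> I" .
  have c: "has_bochner_integral std_normal_pair (\<lambda>z. (1 + k\<^sup>2) * h\<^sup>2 * (indicator {0..k * h} (fst z) * indicator {0..h} (snd z)))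
     ((1 + k\<^sup>2) * h\<^sup>2 * ((std_normal_cdf (k * h) - 1 / 2) * (std_normal_cdf h - 1 / 2)))"
    using has_bochner_integral_mult_right[OF has_bochner_integral_std_normal_pair_mult[OF
      has_bochner_integral_std_normal_indicator[of "{0..k * h}"] has_bochner_integral_std_normal_indicator[of "{0..h}"]],
      of "(1 + k\<^sup>2) * h\<^sup>2"] assms
    by (simp add: measure_std_normal std_normal_cdf_0)
  have "((fst z)\<^sup>2 + (snd z)\<^sup>2) * indicator {0<..h} (snd z) * indicator (wedge k) z
     \<le> (1 + k\<^sup>2) * h\<^sup>2 * (indicator {0..k * h} (fst z) * indicator {0..h} (snd z))" for z :: "real \<times> real"
  proof (cases "z \<in> wedge k \<and> 0 < snd z \<and> snd z \<le> h")
    case True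
    hence z: "0 \<le> fst z" "fst z \<le> k * snd z" "0 < snd z" "snd z \<le> h" by (auto simp: wedge_def)
    have "k * snd z \<le> k * h" using z assms by (intro mult_left_mono) auto
    hence kh: "fst z \<le> k * h" using z by linarith
    have "(fst z)\<^sup>2 \<le> (k * h)\<^sup>2" "(snd z)\<^sup>2 \<le> h\<^sup>2" using z kh by (auto intro: power_mono)
    hence "(fst z)\<^sup>2 + (snd z)\<^sup>2 \<le> (1 + k\<^sup>2) * h\<^sup>2" by (simp add: power_mult_distrib algebra_simps)
    thus ?thesis using z kh True by (simp add: indicator_def)
  next
    case False
    hence "((fst z)\<^sup>2 + (snd z)\<^sup>2) * indicator {0<..h} (snd z) * indicator (wedge k) z = (0 :: real)"
      by (auto simp: indicator_def)
    thus ?thesis by (simp only:) (intro mult_nonneg_nonneg, auto)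
  qed
  hence "(\<integral>z. ((fst z)\<^sup>2 + (snd z)\<^sup>2) * indicator {0<..h} (snd z) * indicator (wedge k) z \<partial>std_normal_pair)
    \<le> (\<integral>z. (1 + k\<^sup>2) * h\<^sup>2 * (indicator {0..k * h} (fst z) * indicator {0..h} (snd z)) \<partial>std_normal_pair)"
    using m c by (intro integral_mono) (auto simp: has_bochner_integral_iff)
  thus "I \<le> (1 + k\<^sup>2) * h\<^sup>2 * ((std_normal_cdf (k * h) - 1 / 2) * (std_normal_cdf h - 1 / 2))"
    unfolding has_bochner_integral_integral_eq[OF m] has_bochner_integral_integral_eq[OF c] .
qed

text \<open>A crude bound in which \<open>1 / (2 * pi)\<close> is replaced by \<open>1\<close>; it makes \<open>h\<^sup>2 * owen_T h k\<close> vanish at infinity.\<close>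

lemma owen_T_le:
  assumes "0 \<le> k"
  shows "owen_T h k \<le> k * exp (- h\<^sup>2 / 2)"
proof -
  have "exp (- h\<^sup>2 * (1 + x\<^sup>2) / 2) / (1 + x\<^sup>2) \<le> exp (- h\<^sup>2 / 2)" for x
  proof -
    have "exp (- h\<^sup>2 * (1 + x\<^sup>2) / 2) / (1 + x\<^sup>2) \<le> exp (- h\<^sup>2 * (1 + x\<^sup>2) / 2) / 1"
      by (intro divide_left_mono) auto
    also have "\<dots> \<le> exp (- h\<^sup>2 / 2)" by (simp add: algebra_simps)
    finally show ?thesis .
  qed
  hence "integral {0..k} (\<lambda>x. exp (- h\<^sup>2 * (1 + x\<^sup>2) / 2) / (1 + x\<^sup>2)) \<le> integral {0..k} (\<lambda>x. exp (- h\<^sup>2 / 2))"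
    by (intro integral_le owen_T_integrable) auto
  also have "\<dots> = k * exp (- h\<^sup>2 / 2)" using assms by simp
  finally have "integral {0..k} (\<lambda>x. exp (- h\<^sup>2 * (1 + x\<^sup>2) / 2) / (1 + x\<^sup>2)) \<le> k * exp (- h\<^sup>2 / 2)" .
  moreover have "1 / (2 * pi) \<le> 1" using pi_gt3 by simp
  ultimately have "1 / (2 * pi) * integral {0..k} (\<lambda>x. exp (- h\<^sup>2 * (1 + x\<^sup>2) / 2) / (1 + x\<^sup>2)) \<le> 1 * (k * exp (- h\<^sup>2 / 2))"
    using assms by (intro mult_mono integral_nonneg owen_T_integrable) auto
  thus ?thesis by (simp add: owen_T_def)
qed

text \<open>The integrand lies between \<open>1 / (1 + x\<^sup>2) - h\<^sup>2 / 2\<close> and \<open>1 / (1 + x\<^sup>2)\<close>, by \<open>1 - u \<le> exp (- u) \<le> 1\<close>.\<close>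

lemma owen_T_near_0:
  assumes "0 \<le> k"
  shows "owen_T h k \<le> arctan k / (2 * pi)" "arctan k / (2 * pi) - h\<^sup>2 * k \<le> owen_T h k"
proof -
  have at: "((\<lambda>t. 1 / (1 + t\<^sup>2)) has_integral (arctan k - arctan 0)) {0..k}"
    using assms by (intro fundamental_theorem_of_calculus)
      (auto intro!: derivative_eq_intros simp: has_real_derivative_iff_has_vector_derivative[symmetric] field_simps)
  have c: "((\<lambda>t. h\<^sup>2 / 2) has_integral k * (h\<^sup>2 / 2)) {0..k}"
    using has_integral_const_real[of "h\<^sup>2 / 2" 0 k] assms by simp
  let ?J = "integral {0..k} (\<lambda>x. exp (- h\<^sup>2 * (1 + x\<^sup>2) / 2) / (1 + x\<^sup>2))"
  have J: "((\<lambda>x. exp (- h\<^sup>2 * (1 + x\<^sup>2) / 2) / (1 + x\<^sup>2)) has_integral ?J) {0..k}"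
    by (rule integrable_integral[OF owen_T_integrable])
  have "?J \<le> arctan k - arctan 0"
    by (rule has_integral_le[OF J at]) (auto intro!: divide_right_mono simp: less_imp_le)
  moreover have "arctan k - arctan 0 - k * (h\<^sup>2 / 2) \<le> ?J"
  proof (rule has_integral_le[OF has_integral_diff[OF at c] J])
    fix x :: real
    have "1 - h\<^sup>2 * (1 + x\<^sup>2) / 2 \<le> exp (- h\<^sup>2 * (1 + x\<^sup>2) / 2)"
      using exp_ge_add_one_self[of "- h\<^sup>2 * (1 + x\<^sup>2) / 2"] by simp
    hence "(1 - h\<^sup>2 * (1 + x\<^sup>2) / 2) / (1 + x\<^sup>2) \<le> exp (- h\<^sup>2 * (1 + x\<^sup>2) / 2) / (1 + x\<^sup>2)"
      by (intro divide_right_mono) (auto simp: less_imp_le)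
    moreover have "(1 - h\<^sup>2 * (1 + x\<^sup>2) / 2) / (1 + x\<^sup>2) = 1 / (1 + x\<^sup>2) - h\<^sup>2 / 2"
    proof -
      have "(1 - h\<^sup>2 * q / 2) / q = 1 / q - h\<^sup>2 / 2" if "q \<noteq> 0" for q
        using that by (simp add: field_simps)
      thus ?thesis by simp
    qed
    ultimately show "1 / (1 + x\<^sup>2) - h\<^sup>2 / 2 \<le> exp (- h\<^sup>2 * (1 + x\<^sup>2) / 2) / (1 + x\<^sup>2)" by simp
  qed
  ultimately have J: "?J \<le> arctan k" "arctan k - k * (h\<^sup>2 / 2) \<le> ?J" by simp_all
  have T: "owen_T h k = ?J / (2 * pi)" by (simp add: owen_T_def)
  show "owen_T h k \<le> arctan k / (2 * pi)" unfolding T using J by (intro divide_right_mono) auto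
  have "arctan k / (2 * pi) - h\<^sup>2 * k \<le> arctan k / (2 * pi) - k * (h\<^sup>2 / 2) / (2 * pi)"
  proof -
    have "k * (h\<^sup>2 / 2) / (2 * pi) \<le> k * h\<^sup>2 / 1"
      using pi_gt3 assms by (intro frac_le) (auto intro: mult_left_mono)
    thus ?thesis by (simp add: mult.commute)
  qed
  also have "\<dots> \<le> owen_T h k" unfolding T diff_divide_distrib[symmetric]
    using J by (intro divide_right_mono) auto
  finally show "arctan k / (2 * pi) - h\<^sup>2 * k \<le> owen_T h k" .
qed

text \<open>Only the local cones at the origin matter: each edge leaves half of \<open>1 / 2\<close>, which cancels against the
\<open>1 / 2\<close> of the segment, and the wedge between them leaves \<open>arctan k / pi\<close>.\<close>

lemma unit_risk_diff_at_top:
  assumes "k > 0"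
  shows "((\<lambda>h. unit_segment_risk k h - unit_triangle_risk k h) \<longlongrightarrow> - (arctan k / pi)) at_top"
proof -
  define r where "r = sqrt (1 + k\<^sup>2)"
  have r: "r > 0" by (simp add: r_def)
  have lin: "filterlim (\<lambda>h. m * h) at_top at_top" if "m > 0" for m :: real
    using that by (simp add: filterlim_tendsto_pos_mult_at_top[OF tendsto_const _ filterlim_ident])
  have xphi: "((\<lambda>x. x * std_normal_density x) \<longlongrightarrow> 0) at_top"
    "((\<lambda>x. x\<^sup>2 * std_normal_density x) \<longlongrightarrow> 0) at_top"
    unfolding std_normal_density_def by real_asymp+
  note Phi = N.cdf_lim_at_top_prob
  have M: "(trunc_moment2 \<longlongrightarrow> 1 - 1 / 2 - 0) at_top"
    unfolding trunc_moment2_def[abs_def] by (intro tendsto_intros Phi xphi)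
  have tail: "((\<lambda>x. x\<^sup>2 * (1 - std_normal_cdf x)) \<longlongrightarrow> 0) at_top"
  proof (rule tendsto_sandwich[OF _ _ tendsto_const xphi(2)])
    show "\<forall>\<^sub>F x in at_top. 0 \<le> x\<^sup>2 * (1 - std_normal_cdf x)" by (simp add: N.cdf_bounded_prob)
    show "\<forall>\<^sub>F x in at_top. x\<^sup>2 * (1 - std_normal_cdf x) \<le> x\<^sup>2 * std_normal_density x"
      using eventually_ge_at_top[of 1] by eventually_elim (intro mult_left_mono std_normal_tail_le, auto)
  qed
  have T2: "((\<lambda>h. h\<^sup>2 * owen_T h k) \<longlongrightarrow> 0) at_top"
  proof (rule tendsto_sandwich[OF _ _ tendsto_const])
    show "((\<lambda>h. h\<^sup>2 * (k * exp (- h\<^sup>2 / 2))) \<longlongrightarrow> 0) at_top" using assms by real_asymp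
  qed (use assms owen_T_le[of k] in \<open>auto intro!: always_eventually mult_left_mono simp: owen_T_nonneg\<close>)
  have T: "((\<lambda>h. owen_T h k) \<longlongrightarrow> 0) at_top"
  proof (rule tendsto_sandwich[OF _ _ tendsto_const])
    show "((\<lambda>h. k * exp (- h\<^sup>2 / 2)) \<longlongrightarrow> 0) at_top" using assms by real_asymp
  qed (use assms owen_T_le[of k] in \<open>auto intro!: always_eventually simp: owen_T_nonneg\<close>)
  note comp = filterlim_compose[OF _ lin]
  \<comment> \<open>Every factor that grows is paired with one that decays faster, so that each summand has a limit of its own.\<close>
  have eq: "unit_segment_risk k h - unit_triangle_risk k h
    = trunc_moment2 (r * h) + (r * h)\<^sup>2 * (1 - std_normal_cdf (r * h)) - (arctan k / pi - 2 * owen_T h k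
       - h * std_normal_density h * (std_normal_cdf (k * h) - 1 / 2)
       + trunc_moment2 (r * h) / 2 + trunc_moment2 h / 2 + (1 - std_normal_cdf h) * trunc_moment2 (k * h)
       + h\<^sup>2 * (1 - std_normal_cdf h) * (std_normal_cdf (k * h) - 1 / 2) + h\<^sup>2 * (1 - std_normal_cdf h) / 2
       + (r * h)\<^sup>2 * (1 - std_normal_cdf (r * h)) / 2 + r\<^sup>2 * (h\<^sup>2 * owen_T h k)
       - r\<^sup>2 * (std_normal_cdf (k * h) - 1 / 2) * (h\<^sup>2 * (1 - std_normal_cdf h)))" for h
    unfolding unit_segment_risk_def unit_triangle_risk_def Let_def r_def[symmetric]
    by (simp add: algebra_simps)
  have "((\<lambda>h. unit_segment_risk k h - unit_triangle_risk k h) \<longlongrightarrow>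
    (1 - 1 / 2 - 0) + 0 - (arctan k / pi - 2 * 0 - 0 * (1 - 1 / 2)
       + (1 - 1 / 2 - 0) / 2 + (1 - 1 / 2 - 0) / 2 + (1 - 1) * (1 - 1 / 2 - 0)
       + 0 * (1 - 1 / 2) + 0 / 2 + 0 / 2 + r\<^sup>2 * 0 - r\<^sup>2 * (1 - 1 / 2) * 0)) at_top"
    unfolding eq
    by (intro tendsto_intros Phi xphi T T2 M tail comp[OF Phi assms] comp[OF M assms] comp[OF M r] comp[OF tail r]) simp_all
  thus ?thesis by simp
qed

text \<open>Only the vertices contribute. For the segment, the end point at distance \<open>a\<close> has probability \<open>1 / 2\<close>; for the
triangle, \<open>(0, h)\<close> and \<open>(k h, h)\<close> have the measures \<open>1 / 4\<close> and \<open>1 / 4 + arctan k / (2 * pi)\<close> of their normal cones.\<close>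

lemma unit_risk_diff_at_right_0:
  assumes "k > 0"
  shows "((\<lambda>h. (unit_segment_risk k h - unit_triangle_risk k h) / h\<^sup>2)
    \<longlongrightarrow> k\<^sup>2 / 4 - (1 + k\<^sup>2) / (2 * pi) * arctan k) (at_right 0)"
proof -
  define r where "r = sqrt (1 + k\<^sup>2)"
  have r: "r > 0" "r\<^sup>2 = 1 + k\<^sup>2" by (simp_all add: r_def)
  define I where "I = (\<lambda>h. arctan k / pi - 2 * owen_T h k - h * std_normal_density h * (std_normal_cdf (k * h) - 1 / 2))"
  have pos: "\<forall>\<^sub>F h in at_right (0::real). h > 0" by (simp add: eventually_at_right_less)
  have Phi: "((\<lambda>h. std_normal_cdf (m * h)) \<longlongrightarrow> 1 / 2) (at_right 0)" if "m > 0" for m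
  proof (rule tendsto_sandwich[OF _ _ tendsto_const])
    show "((\<lambda>h. 1 / 2 + m * h) \<longlongrightarrow> 1 / 2) (at_right 0)" by (auto intro!: tendsto_eq_intros)
    show "\<forall>\<^sub>F h in at_right 0. 1 / 2 \<le> std_normal_cdf (m * h)"
      using pos
    proof eventually_elim
      case (elim h)
      thus ?case using std_normal_cdf_near_0(1)[of "m * h"] that by simp
    qed
    show "\<forall>\<^sub>F h in at_right 0. std_normal_cdf (m * h) \<le> 1 / 2 + m * h"
      using pos
    proof eventually_elim
      case (elim h)
      thus ?case using std_normal_cdf_near_0(2)[of "m * h"] that by simp
    qed
  qed
  note Phi1 = Phi[of 1, simplified]
  have M: "((\<lambda>h. trunc_moment2 (m * h) / h\<^sup>2) \<longlongrightarrow> 0) (at_right 0)" if "m > 0" for m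
  proof (rule tendsto_sandwich[OF _ _ tendsto_const])
    show "((\<lambda>h. m\<^sup>2 * (std_normal_cdf (m * h) - 1 / 2)) \<longlongrightarrow> 0) (at_right 0)"
      using tendsto_mult[OF tendsto_const tendsto_diff[OF Phi[OF that] tendsto_const], of "m\<^sup>2" "1 / 2"] by simp
    show "\<forall>\<^sub>F h in at_right 0. 0 \<le> trunc_moment2 (m * h) / h\<^sup>2"
      using pos
    proof eventually_elim
      case (elim h)
      thus ?case using trunc_moment2_bounds(1)[of "m * h"] that by simp
    qed
    show "\<forall>\<^sub>F h in at_right 0. trunc_moment2 (m * h) / h\<^sup>2 \<le> m\<^sup>2 * (std_normal_cdf (m * h) - 1 / 2)"
      using pos
    proof eventually_elim
      case (elim h)
      thus ?case using trunc_moment2_bounds(2)[of "m * h"] that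
        by (simp add: divide_le_eq power_mult_distrib mult_ac)
    qed
  qed
  note M1 = M[of 1, simplified]
  have T: "((\<lambda>h. owen_T h k) \<longlongrightarrow> arctan k / (2 * pi)) (at_right 0)"
  proof (rule tendsto_sandwich[OF _ _ _ tendsto_const])
    show "((\<lambda>h. arctan k / (2 * pi) - h\<^sup>2 * k) \<longlongrightarrow> arctan k / (2 * pi)) (at_right 0)"
      by (auto intro!: tendsto_eq_intros)
  qed (use assms owen_T_near_0 in \<open>auto intro!: always_eventually\<close>)
  have I: "((\<lambda>h. I h / h\<^sup>2) \<longlongrightarrow> 0) (at_right 0)"
  proof (rule tendsto_sandwich[OF _ _ tendsto_const])
    show "((\<lambda>h. (1 + k\<^sup>2) * ((std_normal_cdf (k * h) - 1 / 2) * (std_normal_cdf h - 1 / 2))) \<longlongrightarrow> 0) (at_right 0)"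
      using tendsto_mult[OF tendsto_const tendsto_mult[OF tendsto_diff[OF Phi[OF assms] tendsto_const]
        tendsto_diff[OF Phi1 tendsto_const]], of "1 + k\<^sup>2" "1 / 2" "1 / 2"] by simp
    show "\<forall>\<^sub>F h in at_right 0. 0 \<le> I h / h\<^sup>2"
      using pos
    proof eventually_elim
      case (elim h)
      thus ?case using wedge_square_bounds(1)[of h k] assms by (simp add: I_def)
    qed
    show "\<forall>\<^sub>F h in at_right 0. I h / h\<^sup>2 \<le> (1 + k\<^sup>2) * ((std_normal_cdf (k * h) - 1 / 2) * (std_normal_cdf h - 1 / 2))"
      using pos
    proof eventually_elim
      case (elim h)
      thus ?case using wedge_square_bounds(2)[of h k] assms
        by (simp only: I_def) (simp add: divide_le_eq mult_ac)
    qed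
  qed
  have eq: "(unit_segment_risk k h - unit_triangle_risk k h) / h\<^sup>2
     = trunc_moment2 (r * h) / h\<^sup>2 + r\<^sup>2 * (1 - std_normal_cdf (r * h)) -
      (I h / h\<^sup>2 + trunc_moment2 (r * h) / h\<^sup>2 / 2 + trunc_moment2 h / h\<^sup>2 / 2
       + (1 - std_normal_cdf h) * (trunc_moment2 (k * h) / h\<^sup>2 + (std_normal_cdf (k * h) - 1 / 2))
       + (1 - std_normal_cdf h) / 2
       + r\<^sup>2 * ((1 - std_normal_cdf (r * h)) / 2 + owen_T h k - (std_normal_cdf (k * h) - 1 / 2) * (1 - std_normal_cdf h)))"
    if "h > 0" for h
  proof -
    define A B C E where "A = trunc_moment2 (r * h) / h\<^sup>2" and "B = trunc_moment2 h / h\<^sup>2"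
      and "C = I h / h\<^sup>2" and "E = trunc_moment2 (k * h) / h\<^sup>2"
    note quotients = this
    have products: "trunc_moment2 (r * h) = A * h\<^sup>2" "trunc_moment2 h = B * h\<^sup>2"
      "trunc_moment2 (k * h) = E * h\<^sup>2"
      "arctan k / pi - 2 * owen_T h k - h * std_normal_density h * (std_normal_cdf (k * h) - 1 / 2) = C * h\<^sup>2"
      using that by (simp_all add: quotients I_def)
    have divide: "X / h\<^sup>2 = Y" if "X = Y * h\<^sup>2" for X Y using that \<open>h > 0\<close> by simp
    show ?thesis
      unfolding unit_segment_risk_def unit_triangle_risk_def Let_def r_def[symmetric] quotients[symmetric] products
      by (rule divide) (simp add: algebra_simps)
  qed
  have "((\<lambda>h. trunc_moment2 (r * h) / h\<^sup>2 + r\<^sup>2 * (1 - std_normal_cdf (r * h)) -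
      (I h / h\<^sup>2 + trunc_moment2 (r * h) / h\<^sup>2 / 2 + trunc_moment2 h / h\<^sup>2 / 2
       + (1 - std_normal_cdf h) * (trunc_moment2 (k * h) / h\<^sup>2 + (std_normal_cdf (k * h) - 1 / 2))
       + (1 - std_normal_cdf h) / 2
       + r\<^sup>2 * ((1 - std_normal_cdf (r * h)) / 2 + owen_T h k - (std_normal_cdf (k * h) - 1 / 2) * (1 - std_normal_cdf h))))
     \<longlongrightarrow> 0 + r\<^sup>2 * (1 - 1 / 2) - (0 + 0 / 2 + 0 / 2 + (1 - 1 / 2) * (0 + (1 / 2 - 1 / 2)) + (1 - 1 / 2) / 2
       + r\<^sup>2 * ((1 - 1 / 2) / 2 + arctan k / (2 * pi) - (1 / 2 - 1 / 2) * (1 - 1 / 2)))) (at_right 0)"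
    by (intro tendsto_intros Phi Phi1 M M1 T I assms r(1)) simp_all
  also have "0 + r\<^sup>2 * (1 - 1 / 2) - (0 + 0 / 2 + 0 / 2 + (1 - 1 / 2) * (0 + (1 / 2 - 1 / 2)) + (1 - 1 / 2) / 2
       + r\<^sup>2 * ((1 - 1 / 2) / 2 + arctan k / (2 * pi) - (1 / 2 - 1 / 2) * (1 - 1 / 2)))
     = k\<^sup>2 / 4 - (1 + k\<^sup>2) / (2 * pi) * arctan k"
    unfolding r(2) by (simp add: field_simps)
  finally show ?thesis
    by (rule Lim_transform_eventually) (use pos in eventually_elim, simp add: eq)
qed

section \<open>Sign of the constant for diverging noise, and conclusion\<close>

text \<open>The difference of the two sides vanishes at \<open>0\<close> and at \<open>pi / 2\<close>. If it were not positive at \<open>x\<close>, the mean value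
theorem on both sides of \<open>x\<close> would contradict that its derivative \<open>cos u - 2 / pi\<close> is strictly decreasing.\<close>

lemma jordan_sin_strict:
  assumes "0 < x" "x < pi / 2"
  shows "2 * x / pi < sin x"
proof (rule ccontr)
  assume "\<not> 2 * x / pi < sin x"
  hence le: "sin x - 2 * x / pi \<le> 0" by simp
  define f where "f = (\<lambda>x. sin x - 2 * x / pi)"
  have D: "(f has_real_derivative (cos u - 2 / pi)) (at u)" for u
    unfolding f_def by (auto intro!: derivative_eq_intros)
  obtain u where u: "0 < u" "u < x" "f x - f 0 = (x - 0) * (cos u - 2 / pi)"
    using MVT2[OF assms(1), of f "\<lambda>u. cos u - 2 / pi"] D by auto
  obtain v where v: "x < v" "v < pi / 2" "f (pi / 2) - f x = (pi / 2 - x) * (cos v - 2 / pi)"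
    using MVT2[OF assms(2), of f "\<lambda>u. cos u - 2 / pi"] D by auto
  have "x * (cos u - 2 / pi) \<le> 0" using u(3) le by (simp add: f_def)
  hence "cos u \<le> 2 / pi" using assms by (simp add: mult_le_0_iff)
  moreover have "0 \<le> (pi / 2 - x) * (cos v - 2 / pi)" using v(3) le by (simp add: f_def)
  hence "2 / pi \<le> cos v" using assms by (simp add: zero_le_mult_iff)
  moreover have "cos v < cos u" using u v assms by (intro cos_monotone_0_pi) auto
  ultimately show False by simp
qed

text \<open>From \<open>cos (arctan k) ^ 2 = 1 / (1 + k\<^sup>2)\<close> one gets \<open>sin x = 2 / (1 + k\<^sup>2) - 1\<close>. This turns the constant into
the defect in Jordan's inequality at \<open>x\<close>, an odd function that vanishes at \<open>x = 0\<close>, that is, at \<open>k = 1\<close>.\<close>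

lemma high_noise_constant_eq:
  fixes k :: real
  defines "x \<equiv> pi / 2 - 2 * arctan k"
  shows "k\<^sup>2 / 4 - (1 + k\<^sup>2) / (2 * pi) * arctan k = (1 + k\<^sup>2) / 8 * (2 * x / pi - sin x)"
proof -
  have "cos (arctan k) \<noteq> 0" using cos_gt_zero_pi[of "arctan k"] arctan_lbound[of k] arctan_ubound[of k] by simp
  have "sin x = 2 * (cos (arctan k))\<^sup>2 - 1"
    by (simp add: x_def sin_diff cos_double_cos)
  also have "(cos (arctan k))\<^sup>2 = 1 / (1 + k\<^sup>2)"
    by (simp add: cos_arctan power_divide)
  finally have "sin x = 2 / (1 + k\<^sup>2) - 1" by simp
  moreover have "2 * x / pi = 1 - 4 * arctan k / pi" by (simp add: x_def field_simps)
  moreover have "q / 8 * ((1 - 4 * A / pi) - (2 / q - 1)) = (q - 1) / 4 - q / (2 * pi) * A" if "q \<noteq> 0" for q A :: real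
    using that by (simp add: field_simps)
  ultimately show ?thesis using one_plus_square_pos(2)[of k] by simp
qed

lemma high_noise_constant_sign:
  fixes k :: real
  assumes "k > 0"
  defines "L \<equiv> k\<^sup>2 / 4 - (1 + k\<^sup>2) / (2 * pi) * arctan k"
  shows "k > 1 \<Longrightarrow> L > 0" "k < 1 \<Longrightarrow> L < 0" "k = 1 \<Longrightarrow> L = 0"
proof -
  define x where "x = pi / 2 - 2 * arctan k"
  have L: "L = (1 + k\<^sup>2) / 8 * (2 * x / pi - sin x)"
    unfolding L_def x_def by (rule high_noise_constant_eq)
  have bounds: "0 < arctan k" "arctan k < pi / 2" using assms arctan_ubound by auto
  show "L > 0" if "k > 1"
  proof -
    have "pi / 4 < arctan k" using that arctan_monotone[of 1 k] by (simp add: arctan_one)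
    hence "2 * (- x) / pi < sin (- x)" using bounds by (intro jordan_sin_strict) (auto simp: x_def)
    thus ?thesis unfolding L by (intro mult_pos_pos) auto
  qed
  show "L < 0" if "k < 1"
  proof -
    have "arctan k < pi / 4" using that arctan_monotone[of k 1] by (simp add: arctan_one)
    hence "2 * x / pi < sin x" using bounds by (intro jordan_sin_strict) (auto simp: x_def)
    thus ?thesis unfolding L by (intro mult_pos_neg) auto
  qed
  show "L = 0" if "k = 1" using that by (simp add: L_def arctan_one)
qed

lemma scaled_hypotenuse:
  assumes "c > 0" "\<sigma> > 0"
  shows "sqrt (1 + (1 / c)\<^sup>2) * (1 / \<sigma>) = sqrt (1 + c\<^sup>2) / (c * \<sigma>)"
    and "\<sigma>\<^sup>2 * (sqrt (1 + c\<^sup>2) / (c * \<sigma>))\<^sup>2 = (1 + c\<^sup>2) / c\<^sup>2"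
proof -
  have "1 + (1 / c)\<^sup>2 = (1 + c\<^sup>2) / c\<^sup>2" using assms by (simp add: field_simps)
  hence "sqrt (1 + (1 / c)\<^sup>2) = sqrt (1 + c\<^sup>2) / c" using assms by (simp add: real_sqrt_divide)
  thus "sqrt (1 + (1 / c)\<^sup>2) * (1 / \<sigma>) = sqrt (1 + c\<^sup>2) / (c * \<sigma>)" by simp
  show "\<sigma>\<^sup>2 * (sqrt (1 + c\<^sup>2) / (c * \<sigma>))\<^sup>2 = (1 + c\<^sup>2) / c\<^sup>2"
    using assms by (simp add: power_divide power_mult_distrib)
qed

lemma segment_risk_unit:
  assumes "c > 0" "\<sigma> > 0"
  shows "segment_risk c \<sigma> = \<sigma>\<^sup>2 * unit_segment_risk (1 / c) (1 / \<sigma>)"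
  unfolding segment_risk_def unit_segment_risk_def Let_def scaled_hypotenuse(1)[OF assms]
    scaled_hypotenuse(2)[OF assms, symmetric] by (simp only: distrib_left mult.assoc)

lemma triangle_risk_unit:
  assumes "c > 0" "\<sigma> > 0"
  shows "triangle_risk c \<sigma> = \<sigma>\<^sup>2 * unit_triangle_risk (1 / c) (1 / \<sigma>)"
proof -
  define h a b \<Phi>a \<Phi>b \<Phi>h T ma mb mh where "h = 1 / \<sigma>" and "a = sqrt (1 + c\<^sup>2) / (c * \<sigma>)"
    and "b = 1 / (c * \<sigma>)" and "\<Phi>a = std_normal_cdf a" and "\<Phi>b = std_normal_cdf b" and "\<Phi>h = std_normal_cdf h"
    and "T = owen_T h (1 / c)" and "ma = trunc_moment2 a" and "mb = trunc_moment2 b" and "mh = trunc_moment2 h"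
  note defs = this
  define Q where "Q = (1 + c\<^sup>2) / c\<^sup>2"
  have kh: "1 / c * h = b" by (simp add: h_def b_def)
  have h2: "\<sigma>\<^sup>2 * h\<^sup>2 = 1" using assms by (simp add: h_def power_divide)
  have "\<sigma>\<^sup>2 * unit_triangle_risk (1 / c) (1 / \<sigma>) =
     \<sigma>\<^sup>2 * (arctan (1 / c) / pi - 2 * T - h * std_normal_density h * (\<Phi>b - 1 / 2))
      + \<sigma>\<^sup>2 * ma / 2 + \<sigma>\<^sup>2 * mh / 2
      + (1 - \<Phi>h) * (\<sigma>\<^sup>2 * mb + (\<sigma>\<^sup>2 * h\<^sup>2) * (\<Phi>b - 1 / 2))
      + (\<sigma>\<^sup>2 * h\<^sup>2) * ((1 - \<Phi>h) / 2)
      + (\<sigma>\<^sup>2 * a\<^sup>2) * ((1 - \<Phi>a) / 2 + T - (\<Phi>b - 1 / 2) * (1 - \<Phi>h))"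
    unfolding unit_triangle_risk_def Let_def scaled_hypotenuse(1)[OF assms, folded h_def a_def] h_def[symmetric] kh
      defs(4-)[symmetric] by (simp add: algebra_simps)
  also have "\<dots> = triangle_risk c \<sigma>"
    unfolding triangle_risk_def Let_def h_def[symmetric] b_def[symmetric] a_def[symmetric] defs(4-)[symmetric]
      h2 scaled_hypotenuse(2)[OF assms, folded a_def] Q_def[symmetric] by (simp add: field_simps)
  finally show ?thesis ..
qed

lemma ls_risk_segment:
  assumes "c > 0" "\<sigma> > 0"
  shows "ls_risk \<sigma> 0 (convex hull {0, vector [inverse c, 1] :: real^2}) = \<sigma>\<^sup>2 * unit_segment_risk (1 / c) (1 / \<sigma>)"
proof -
  let ?S = "convex hull {0, vector [1 / c * (1 / \<sigma>), 1 / \<sigma>] :: real^2}"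
  have "\<sigma> *\<^sub>R (vector [1 / c * (1 / \<sigma>), 1 / \<sigma>] :: real^2) = vector [inverse c, 1]"
    using assms by (simp add: vec_eq_iff forall_2 field_simps)
  hence "convex hull {0, vector [inverse c, 1]} = (*\<^sub>R) \<sigma> ` ?S"
    by (simp add: convex_hull_scaling[symmetric])
  moreover have "ls_risk \<sigma> 0 ((*\<^sub>R) \<sigma> ` ?S) = \<sigma>\<^sup>2 * ls_risk 1 0 ?S"
    using assms by (intro ls_risk_scaled compact_imp_closed finite_imp_compact_convex_hull) auto
  ultimately show ?thesis
    using assms ls_risk_unit_segment[of "1 / c" "1 / \<sigma>"] by simp
qed

lemma ls_risk_triangle:
  assumes "c > 0" "\<sigma> > 0"
  shows "ls_risk \<sigma> 0 (convex hull {0, vector [inverse c, 1] :: real^2, vector [0, 1]})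
    = \<sigma>\<^sup>2 * unit_triangle_risk (1 / c) (1 / \<sigma>)"
proof -
  let ?S = "convex hull {0, vector [1 / c * (1 / \<sigma>), 1 / \<sigma>] :: real^2, vector [0, 1 / \<sigma>]}"
  have "\<sigma> *\<^sub>R (vector [1 / c * (1 / \<sigma>), 1 / \<sigma>] :: real^2) = vector [inverse c, 1]"
    "\<sigma> *\<^sub>R (vector [0, 1 / \<sigma>] :: real^2) = vector [0, 1]"
    using assms by (simp_all add: vec_eq_iff forall_2 field_simps)
  hence "convex hull {0, vector [inverse c, 1], vector [0, 1]} = (*\<^sub>R) \<sigma> ` ?S"
    by (simp add: convex_hull_scaling[symmetric])
  moreover have "ls_risk \<sigma> 0 ((*\<^sub>R) \<sigma> ` ?S) = \<sigma>\<^sup>2 * ls_risk 1 0 ?S"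
    using assms by (intro ls_risk_scaled compact_imp_closed finite_imp_compact_convex_hull) auto
  moreover have "ls_risk 1 0 ?S = unit_triangle_risk (1 / c) (1 / \<sigma>)"
    by (rule ls_risk_unit_triangle) (use assms in auto)
  ultimately show ?thesis by simp
qed

theorem theorem1p1:
  fixes c :: real and v1 v2 v3 \<theta> :: "real ^ 2" and \<Theta>\<^sub>L \<Theta>\<^sub>S :: "(real ^ 2) set"
    and R\<^sub>S R\<^sub>L :: "real \<Rightarrow> real" and K :: real
  assumes "c > 0"
    and "v1 = vector [0, 0]" and "v2 = vector [inverse c, 1]" and "v3 = vector [0, 1]"
    and "\<Theta>\<^sub>L = convex hull {v1, v2, v3}" and "\<Theta>\<^sub>S = convex hull {v1, v2}"
    and "\<theta> = v1"
    and "R\<^sub>S = (\<lambda>\<sigma>. ls_risk \<sigma> \<theta> \<Theta>\<^sub>S)" and "R\<^sub>L = (\<lambda>\<sigma>. ls_risk \<sigma> \<theta> \<Theta>\<^sub>L)"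
    and "K = 1 / (4 * c\<^sup>2) - (1 + c\<^sup>2) / (2 * pi * c\<^sup>2) * arctan (1 / c)"
  shows "(\<forall>\<sigma>>0. R\<^sub>S \<sigma> = segment_risk c \<sigma> \<and> R\<^sub>L \<sigma> = triangle_risk c \<sigma>)
    \<and> (\<lambda>\<sigma>. (R\<^sub>S \<sigma> - R\<^sub>L \<sigma>) - (- (\<sigma>\<^sup>2 / pi) * arctan (1 / c))) \<in> o[at_right 0](\<lambda>\<sigma>. \<sigma>\<^sup>2)
    \<and> (\<exists>\<sigma>\<^sub>0>0. \<forall>\<sigma>\<in>{0<..<\<sigma>\<^sub>0}. R\<^sub>S \<sigma> < R\<^sub>L \<sigma>)
    \<and> (\<lambda>\<sigma>. (R\<^sub>S \<sigma> - R\<^sub>L \<sigma>) - K) \<in> o[at_top](\<lambda>\<sigma>. 1)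
    \<and> (c \<noteq> 1 \<longrightarrow> (\<exists>\<sigma>\<^sub>1>0. \<forall>\<sigma>\<in>{\<sigma>\<^sub>1<..}.
          (c < 1 \<longrightarrow> R\<^sub>S \<sigma> > R\<^sub>L \<sigma>) \<and> (c > 1 \<longrightarrow> R\<^sub>S \<sigma> < R\<^sub>L \<sigma>)))
    \<and> (c = 1 \<longrightarrow> K = 0 \<and> (\<lambda>\<sigma>. R\<^sub>S \<sigma> - R\<^sub>L \<sigma>) \<in> o[at_top](\<lambda>\<sigma>. 1))"
proof -
  define k where "k = 1 / c"
  have c: "c > 0" and k: "k > 0" using assms(1) by (simp_all add: k_def)
  have \<theta>: "\<theta> = 0" "v1 = 0" using assms by (simp_all add: vec_eq_iff forall_2)
  define D where "D = (\<lambda>h. unit_segment_risk k h - unit_triangle_risk k h)"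
  have R: "R\<^sub>S \<sigma> = \<sigma>\<^sup>2 * unit_segment_risk k (1 / \<sigma>)" "R\<^sub>L \<sigma> = \<sigma>\<^sup>2 * unit_triangle_risk k (1 / \<sigma>)"
    if "\<sigma> > 0" for \<sigma>
    using ls_risk_segment[OF c that] ls_risk_triangle[OF c that] assms(3-6,8,9) \<theta> by (simp_all add: k_def)
  have closed_forms: "\<forall>\<sigma>>0. R\<^sub>S \<sigma> = segment_risk c \<sigma> \<and> R\<^sub>L \<sigma> = triangle_risk c \<sigma>"
    using R segment_risk_unit[OF c] triangle_risk_unit[OF c] by (simp add: k_def)
  have diff: "R\<^sub>S \<sigma> - R\<^sub>L \<sigma> = \<sigma>\<^sup>2 * D (1 / \<sigma>)" if "\<sigma> > 0" for \<sigma>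
    using R[OF that] by (simp add: D_def algebra_simps)
  have K: "K = k\<^sup>2 / 4 - (1 + k\<^sup>2) / (2 * pi) * arctan k"
  proof -
    have "(1 + c\<^sup>2) / (2 * pi * c\<^sup>2) = (1 + k\<^sup>2) / (2 * pi)" "1 / (4 * c\<^sup>2) = k\<^sup>2 / 4"
      using c by (simp_all add: k_def field_simps)
    thus ?thesis unfolding assms(10) k_def[symmetric] by simp
  qed
  have pos0: "\<forall>\<^sub>F \<sigma> in at_right (0::real). \<sigma> > 0" by (simp add: eventually_at_right_less)
  have pos1: "\<forall>\<^sub>F \<sigma> in at_top. \<sigma> > (0::real)" by (rule eventually_gt_at_top)

  have "((\<lambda>\<sigma>. D (1 / \<sigma>)) \<longlongrightarrow> - (arctan k / pi)) (at_right 0)"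
  proof (rule filterlim_compose[where g = D])
    show "(D \<longlongrightarrow> - (arctan k / pi)) at_top" unfolding D_def by (rule unit_risk_diff_at_top[OF k])
    show "filterlim (\<lambda>\<sigma>. 1 / \<sigma> :: real) at_top (at_right 0)" by real_asymp
  qed
  hence low: "((\<lambda>\<sigma>. (R\<^sub>S \<sigma> - R\<^sub>L \<sigma>) / \<sigma>\<^sup>2) \<longlongrightarrow> - (arctan k / pi)) (at_right 0)"
    by (rule Lim_transform_eventually) (use pos0 in eventually_elim, simp add: diff)
  have high: "((\<lambda>\<sigma>. R\<^sub>S \<sigma> - R\<^sub>L \<sigma>) \<longlongrightarrow> K) at_top"
  proof -
    have "((\<lambda>\<sigma>. D (1 / \<sigma>) / (1 / \<sigma>)\<^sup>2) \<longlongrightarrow> K) at_top"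
    proof (rule filterlim_compose[where g = "\<lambda>h. D h / h\<^sup>2"])
      show "((\<lambda>h. D h / h\<^sup>2) \<longlongrightarrow> K) (at_right 0)" unfolding D_def K by (rule unit_risk_diff_at_right_0[OF k])
      show "filterlim (\<lambda>\<sigma>. 1 / \<sigma> :: real) (at_right 0) at_top" by real_asymp
    qed
    thus ?thesis
      by (rule Lim_transform_eventually) (use pos1 in eventually_elim, simp add: diff power_divide)
  qed

  have small_o_low: "(\<lambda>\<sigma>. (R\<^sub>S \<sigma> - R\<^sub>L \<sigma>) - (- (\<sigma>\<^sup>2 / pi) * arctan (1 / c))) \<in> o[at_right 0](\<lambda>\<sigma>. \<sigma>\<^sup>2)"
  proof (rule smalloI_tendsto)
    have "((\<lambda>\<sigma>. (R\<^sub>S \<sigma> - R\<^sub>L \<sigma>) / \<sigma>\<^sup>2 + arctan k / pi) \<longlongrightarrow> - (arctan k / pi) + arctan k / pi) (at_right 0)"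
      by (intro tendsto_add low tendsto_const)
    hence "((\<lambda>\<sigma>. (R\<^sub>S \<sigma> - R\<^sub>L \<sigma>) / \<sigma>\<^sup>2 + arctan k / pi) \<longlongrightarrow> 0) (at_right 0)" by simp
    thus "((\<lambda>\<sigma>. ((R\<^sub>S \<sigma> - R\<^sub>L \<sigma>) - (- (\<sigma>\<^sup>2 / pi) * arctan (1 / c))) / \<sigma>\<^sup>2) \<longlongrightarrow> 0) (at_right 0)"
      by (rule Lim_transform_eventually)
        (use pos0 in eventually_elim, simp add: k_def[symmetric] add_divide_distrib)
    show "\<forall>\<^sub>F \<sigma> in at_right 0. \<sigma>\<^sup>2 \<noteq> (0::real)" using pos0 by eventually_elim simp
  qed
  have "\<forall>\<^sub>F \<sigma> in at_right 0. (R\<^sub>S \<sigma> - R\<^sub>L \<sigma>) / \<sigma>\<^sup>2 < 0"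
    using order_tendstoD(2)[OF low, of 0] k by simp
  hence "\<forall>\<^sub>F \<sigma> in at_right 0. R\<^sub>S \<sigma> < R\<^sub>L \<sigma>"
    using pos0 by eventually_elim (simp add: divide_less_0_iff)
  hence order_low: "\<exists>\<sigma>\<^sub>0>0. \<forall>\<sigma>\<in>{0<..<\<sigma>\<^sub>0}. R\<^sub>S \<sigma> < R\<^sub>L \<sigma>"
    unfolding eventually_at_right_field by auto

  have "((\<lambda>\<sigma>. (R\<^sub>S \<sigma> - R\<^sub>L \<sigma>) - K) \<longlongrightarrow> 0) at_top"
    using high by (simp add: LIM_zero_iff)
  hence small_o_high: "(\<lambda>\<sigma>. (R\<^sub>S \<sigma> - R\<^sub>L \<sigma>) - K) \<in> o[at_top](\<lambda>\<sigma>. 1)"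
    by (intro smalloI_tendsto) auto
  have order_high: "\<exists>\<sigma>\<^sub>1>0. \<forall>\<sigma>\<in>{\<sigma>\<^sub>1<..}. (c < 1 \<longrightarrow> R\<^sub>S \<sigma> > R\<^sub>L \<sigma>) \<and> (c > 1 \<longrightarrow> R\<^sub>S \<sigma> < R\<^sub>L \<sigma>)"
  proof -
    have K_sign: "c < 1 \<Longrightarrow> K > 0" "c > 1 \<Longrightarrow> K < 0"
      using high_noise_constant_sign(1,2)[OF k] c unfolding K by (simp_all add: k_def)
    have "\<forall>\<^sub>F \<sigma> in at_top. (c < 1 \<longrightarrow> R\<^sub>S \<sigma> > R\<^sub>L \<sigma>) \<and> (c > 1 \<longrightarrow> R\<^sub>S \<sigma> < R\<^sub>L \<sigma>)"
    proof (cases "c < 1")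
      case True
      from order_tendstoD(1)[OF high K_sign(1)[OF True]] True show ?thesis by (auto elim: eventually_mono)
    next
      case False
      show ?thesis
      proof (cases "c > 1")
        case True
        from order_tendstoD(2)[OF high K_sign(2)[OF True]] True show ?thesis by (auto elim: eventually_mono)
      qed (use False in simp)
    qed
    then obtain N where "\<And>\<sigma>. \<sigma> > N \<Longrightarrow> (c < 1 \<longrightarrow> R\<^sub>S \<sigma> > R\<^sub>L \<sigma>) \<and> (c > 1 \<longrightarrow> R\<^sub>S \<sigma> < R\<^sub>L \<sigma>)"
      unfolding eventually_at_top_dense by auto
    thus ?thesis by (intro exI[of _ "max N 1"]) auto
  qed
  have "K = 0" if "c = 1" using high_noise_constant_sign(3)[OF k] that unfolding K by (simp add: k_def)
  hence "c = 1 \<longrightarrow> K = 0 \<and> (\<lambda>\<sigma>. R\<^sub>S \<sigma> - R\<^sub>L \<sigma>) \<in> o[at_top](\<lambda>\<sigma>. 1)"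
    using small_o_high by auto
  thus ?thesis using closed_forms small_o_low order_low small_o_high order_high by blast
qed

end
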